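(* For every distribution $\mu\in\mathcal{G}_1$, the power series $S_\mu$ (the $S$-transform of $\mu$) and $LS_\mu$ (the $LS$-transform of $\mu$) are related by $$LS_\mu(z)=-z\log S_\mu(z).$$
   Context: $\mathcal{G}_1$ is the set of linear functionals $\mu:\mathbb{C}[X]\to\mathbb{C}$ with $\mu(1)=1$ and $\mu(X)=1$. $S$-transform. For $\mu\in\mathcal{G}_1$ let $M_\mu(z)=z+\sum_{n\ge2}\mu(X^n)z^n\in\mathbb{C}[[z]]$ and $S_\mu(z):=\frac{1+z}{z}M_\mu^{\langle-1\rangle}(z)$, where $\langle-1\rangle$ denotes inverse under composition. Then $S_\mu$ has constant term $1$. For a series $f$ with constant term $1$, $\log f:=-\sum_{n\ge1}\frac1n(1-f)^n$. Non-crossing partitions. $NC(n)$ is the lattice of non-crossing partitions of $\{1,\dots,n\}$ ordered by reversed refinement, with minimum $0_n$ and maximum $1_n$. For $\pi\in NC(n)$, $P_\pi$ is the permutation of $\{1,\dots,n\}$ which maps cyclically $b_1\mapsto b_2\mapsto\cdots\mapsto b_m\mapsto b_1$ on every block $\{b_1<\dots<b_m\}$ of $\pi$. The Kreweras complement $K(\pi)\in NC(n)$ is determined by $P_{K(\pi)}=P_\pi^{-1}P_{1_n}$. $R$-transform. $R_\mu(z)=\sum_{n\ge1}\alpha_nz^n$ is the unique series with $\mu(X^n)=\sum_{\pi\in NC(n)}\prod_{B\text{ block of }\pi}\alpha_{|B|}$ for all $n\ge1$; for $\mu\in\mathcal{G}_1$, $\alpha_1=1$. The Hopf algebra $\mathcal{Y}^{(1)}$.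 As an algebra, $\mathcal{Y}^{(1)}=\mathbb{C}[Y_n\mid n\ge2]$ (commutative polynomials). Put $Y_1:=1$ and $Y_\pi:=\prod_{A\text{ block of }\pi}Y_{|A|}$ for $\pi\in NC(n)$. The comultiplication $\Delta$ is the unital algebra homomorphism with $\Delta(Y_n)=\sum_{\pi\in NC(n)}Y_\pi\otimes Y_{K(\pi)}$ for $n\ge2$, and the counit $\varepsilon$ is the unital algebra homomorphism with $\varepsilon(Y_n)=0$ for $n\ge2$. With these, $\mathcal{Y}^{(1)}$ is a graded connected Hopf algebra, $Y_n$ being homogeneous of degree $n-1$. The convolution of linear functionals $\xi,\eta$ on $\mathcal{Y}^{(1)}$ is $\xi\eta:=(\xi\otimes\eta)\circ\Delta$. For a linear functional $\eta$ with $\eta(1)=1$, $\log\eta:=-\sum_{\ell=1}^\infty\frac1\ell(\varepsilon-\eta)^\ell$ (convolution powers; on each homogeneous component only finitely many terms are non-zero). $LS$-transform. $\chi_\mu:\mathcal{Y}^{(1)}\to\mathbb{C}$ is the unital algebra homomorphism with $\chi_\mu(Y_n)=\alpha_n$ for $n\ge2$, and $LS_\mu(z):=\sum_{n=2}^\infty\big((\log\chi_\mu)(Y_n)\big)z^n$. *)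

theory Defs
  imports
    "HOL-Library.Poly_Mapping"
    "HOL-Library.Product_Plus"
    "HOL-Library.Disjoint_Sets"
    "HOL-Computational_Algebra.Computational_Algebra"
begin

section \<open>Distributions and the $S$-transform\<close>

definition G1 :: "(complex poly \<Rightarrow> complex) set" where
  "G1 = {\<mu>. Vector_Spaces.linear smult (*) \<mu> \<and> \<mu> 1 = 1 \<and> \<mu> (monom 1 1) = 1}"

definition moment_series :: "(complex poly \<Rightarrow> complex) \<Rightarrow> complex fps" where
  "moment_series \<mu> = fps_X + Abs_fps (\<lambda>n. if n \<ge> 2 then \<mu> (monom 1 n) else 0)"

text \<open>The product is taken before dividing by \<^term>\<open>fps_X\<close>: division in \<^typ>\<open>complex fps\<close>
  is Euclidean, and only the product (which has zero constant term) is divisible.\<close>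

definition S_transform :: "(complex poly \<Rightarrow> complex) \<Rightarrow> complex fps" where
  "S_transform \<mu> = ((1 + fps_X) * fps_inv (moment_series \<mu>)) / fps_X"

text \<open>The infinite sum is taken in the $X$-adic topology; it converges when \<open>f\<close> has
  constant term $1$.\<close>

definition fps_log :: "complex fps \<Rightarrow> complex fps" where
  "fps_log f = - suminf (\<lambda>k. fps_const (1 / of_nat (Suc k)) * (1 - f) ^ Suc k)"


section \<open>Non-crossing partitions\<close>

definition noncrossing :: "nat set set \<Rightarrow> bool" where
  "noncrossing \<pi> \<longleftrightarrow>
     \<not> (\<exists>A\<in>\<pi>. \<exists>B\<in>\<pi>. A \<noteq> B \<and>
          (\<exists>a b c d. a < b \<and> b < c \<and> c < d \<and> a \<in> A \<and> c \<in> A \<and> b \<in> B \<and> d \<in> B))"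

definition NC :: "nat \<Rightarrow> nat set set set" where
  "NC n = {\<pi>. partition_on {1..n} \<pi> \<and> noncrossing \<pi>}"

definition next_in_block :: "nat set \<Rightarrow> nat \<Rightarrow> nat" where
  "next_in_block B i = (if \<exists>j\<in>B. i < j then Min {j \<in> B. i < j} else Min B)"

text \<open>\<open>perm_of \<pi>\<close> is extended by the identity outside $\{1,\dots,n\}$.\<close>

definition perm_of :: "nat set set \<Rightarrow> nat \<Rightarrow> nat" where
  "perm_of \<pi> i =
     (if i \<in> \<Union>\<pi> then next_in_block (THE B. B \<in> \<pi> \<and> i \<in> B) i else i)"

text \<open>For \<open>n \<ge> 1\<close>, the maximum $1_n$ is the one-block partition.\<close>

definition Kreweras :: "nat \<Rightarrow> nat set set \<Rightarrow> nat set set" where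
  "Kreweras n \<pi> =
     (THE \<sigma>. \<sigma> \<in> NC n \<and> perm_of \<sigma> = inv (perm_of \<pi>) \<circ> perm_of {{1..n}})"

definition R_transform :: "(complex poly \<Rightarrow> complex) \<Rightarrow> complex fps" where
  "R_transform \<mu> =
     (THE R. fps_nth R 0 = 0 \<and>
        (\<forall>n\<ge>1. \<mu> (monom 1 n) = (\<Sum>\<pi>\<in>NC n. \<Prod>B\<in>\<pi>. fps_nth R (card B))))"


section \<open>The Hopf algebra\<close>

text \<open>A monomial is an exponent function of finite support, in which index \<open>k\<close> carries the
  exponent of $Y_{k+2}$. So the following is the polynomial algebra in $Y_2, Y_3, \dots$\<close>

type_synonym Ymon = "nat \<Rightarrow>\<^sub>0 nat"
type_synonym Yalg = "Ymon \<Rightarrow>\<^sub>0 complex"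

text \<open>The tensor square of \<^typ>\<open>Yalg\<close>: its elements are finite linear combinations of pairs
  of monomials \<open>(m, m')\<close>, which stand for the basis vectors $m \otimes m'$; such pairs
  multiply componentwise.\<close>

type_synonym Yalg2 = "(Ymon \<times> Ymon) \<Rightarrow>\<^sub>0 complex"

definition Ygen :: "nat \<Rightarrow> Yalg" where
  "Ygen n = (if n < 2 then 1 else Poly_Mapping.single (Poly_Mapping.single (n - 2) 1) 1)"

definition Ypart :: "nat set set \<Rightarrow> Yalg" where
  "Ypart \<pi> = (\<Prod>A\<in>\<pi>. Ygen (card A))"

definition tensor :: "Yalg \<Rightarrow> Yalg \<Rightarrow> Yalg2" where
  "tensor p q = (\<Sum>m\<in>Poly_Mapping.keys p. \<Sum>m'\<in>Poly_Mapping.keys q.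
     Poly_Mapping.single (m, m') (Poly_Mapping.lookup p m * Poly_Mapping.lookup q m'))"

text \<open>The unital algebra homomorphism on \<^typ>\<open>Yalg\<close> that sends $Y_n$ to \<open>v n\<close> for \<open>n \<ge> 2\<close>,
  where \<open>\<iota>\<close> is the embedding of scalars into the target algebra
  (lemmas \<open>Yextend_hom\<close> and \<open>Yextend_unique\<close> below).\<close>

definition Yextend :: "(complex \<Rightarrow> 'b::comm_ring_1) \<Rightarrow> (nat \<Rightarrow> 'b) \<Rightarrow> Yalg \<Rightarrow> 'b" where
  "Yextend \<iota> v p = (\<Sum>m\<in>Poly_Mapping.keys p. \<iota> (Poly_Mapping.lookup p m) *
     (\<Prod>k\<in>Poly_Mapping.keys m. v (k + 2) ^ Poly_Mapping.lookup m k))"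

definition comult :: "Yalg \<Rightarrow> Yalg2" where
  "comult = Yextend (Poly_Mapping.single 0)
     (\<lambda>n. \<Sum>\<pi>\<in>NC n. tensor (Ypart \<pi>) (Ypart (Kreweras n \<pi>)))"

definition counit :: "Yalg \<Rightarrow> complex" where
  "counit = Yextend id (\<lambda>n. 0)"

definition tensor_functional ::
  "(Yalg \<Rightarrow> complex) \<Rightarrow> (Yalg \<Rightarrow> complex) \<Rightarrow> Yalg2 \<Rightarrow> complex" where
  "tensor_functional \<xi> \<eta> t = (\<Sum>(m, m')\<in>Poly_Mapping.keys t.
     Poly_Mapping.lookup t (m, m') *
       (\<xi> (Poly_Mapping.single m 1) * \<eta> (Poly_Mapping.single m' 1)))"

definition convolution ::
  "(Yalg \<Rightarrow> complex) \<Rightarrow> (Yalg \<Rightarrow> complex) \<Rightarrow> Yalg \<Rightarrow> complex" where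
  "convolution \<xi> \<eta> = tensor_functional \<xi> \<eta> \<circ> comult"

primrec conv_power :: "(Yalg \<Rightarrow> complex) \<Rightarrow> nat \<Rightarrow> Yalg \<Rightarrow> complex" where
  "conv_power \<xi> 0 = counit"
| "conv_power \<xi> (Suc l) = convolution \<xi> (conv_power \<xi> l)"

definition conv_log :: "(Yalg \<Rightarrow> complex) \<Rightarrow> Yalg \<Rightarrow> complex" where
  "conv_log \<eta> p =
     - suminf (\<lambda>l. 1 / of_nat (Suc l) * conv_power (\<lambda>q. counit q - \<eta> q) (Suc l) p)"


section \<open>The $LS$-transform\<close>

definition LS_character :: "(complex poly \<Rightarrow> complex) \<Rightarrow> Yalg \<Rightarrow> complex" where
  "LS_character \<mu> = Yextend id (fps_nth (R_transform \<mu>))"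

definition LS_transform :: "(complex poly \<Rightarrow> complex) \<Rightarrow> complex fps" where
  "LS_transform \<mu> =
     Abs_fps (\<lambda>n. if n \<ge> 2 then conv_log (LS_character \<mu>) (Ygen n) else 0)"

section \<open>Consistency of the definitions\<close>

lemma poly_mapping_induct [case_names single sum]:
  fixes p :: "'a \<Rightarrow>\<^sub>0 'b::monoid_add"
  assumes single: "\<And>k d. P (Poly_Mapping.single k d)"
    and sum: "\<And>f g. P f \<Longrightarrow> P g \<Longrightarrow> P (f + g)"
  shows "P p"
proof (induction p rule: update_induct)
  case const
  show ?case using single[of undefined 0] by simp
next
  case (update f a b)
  have "Poly_Mapping.update a b f = Poly_Mapping.single a b + f"
    using update(1)
    by (intro poly_mapping_eqI) (auto simp: lookup_update lookup_add lookup_single in_keys_iff)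
  then show ?case using sum[OF single update(3)] by simp
qed

lemma Yextend_superset:
  assumes "finite S" "Poly_Mapping.keys p \<subseteq> S" "\<iota> 0 = 0"
  shows "Yextend \<iota> v p = (\<Sum>m\<in>S. \<iota> (Poly_Mapping.lookup p m) *
     (\<Prod>k\<in>Poly_Mapping.keys m. v (k + 2) ^ Poly_Mapping.lookup m k))"
  unfolding Yextend_def using assms
  by (intro sum.mono_neutral_left) (auto simp: in_keys_iff)

lemma Yextend_single:
  assumes "\<iota> 0 = 0"
  shows "Yextend \<iota> v (Poly_Mapping.single m c) =
    \<iota> c * (\<Prod>k\<in>Poly_Mapping.keys m. v (k + 2) ^ Poly_Mapping.lookup m k)"
  by (subst Yextend_superset[where S="{m}"]) (use assms in \<open>auto simp: lookup_single\<close>)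

lemma Yextend_add:
  assumes "\<iota> 0 = 0" "\<And>a b. \<iota> (a + b) = \<iota> a + \<iota> b"
  shows "Yextend \<iota> v (p + q) = Yextend \<iota> v p + Yextend \<iota> v q"
proof -
  let ?S = "Poly_Mapping.keys p \<union> Poly_Mapping.keys q"
  have "Poly_Mapping.keys (p + q) \<subseteq> ?S" by (rule Poly_Mapping.keys_add)
  then show ?thesis
    using assms by (simp add: Yextend_superset[where S="?S"] lookup_add distrib_right sum.distrib)
qed

lemma monomial_value_add:
  fixes v :: "nat \<Rightarrow> 'b::comm_ring_1" and m m' :: Ymon
  shows "(\<Prod>k\<in>Poly_Mapping.keys (m + m'). v (k + 2) ^ Poly_Mapping.lookup (m + m') k) =
    (\<Prod>k\<in>Poly_Mapping.keys m. v (k + 2) ^ Poly_Mapping.lookup m k) *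
    (\<Prod>k\<in>Poly_Mapping.keys m'. v (k + 2) ^ Poly_Mapping.lookup m' k)"
proof -
  let ?S = "Poly_Mapping.keys m \<union> Poly_Mapping.keys m'"
  have ext: "(\<Prod>k\<in>Poly_Mapping.keys x. v (k + 2) ^ Poly_Mapping.lookup x k) =
      (\<Prod>k\<in>?S. v (k + 2) ^ Poly_Mapping.lookup x k)"
    if "Poly_Mapping.keys x \<subseteq> ?S" for x :: Ymon
    using that by (intro prod.mono_neutral_left) (auto simp: in_keys_iff)
  have "Poly_Mapping.keys (m + m') \<subseteq> ?S" by (rule Poly_Mapping.keys_add)
  then show ?thesis
    by (subst ext[of "m + m'"], assumption) (simp only: ext[of m] ext[of m'] Un_upper1 Un_upper2
        lookup_add power_add prod.distrib)
qed

lemma Yextend_hom: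
  fixes \<iota> :: "complex \<Rightarrow> 'b::comm_ring_1"
  assumes "\<iota> 0 = 0" "\<iota> 1 = 1" "\<And>a b. \<iota> (a + b) = \<iota> a + \<iota> b" "\<And>a b. \<iota> (a * b) = \<iota> a * \<iota> b"
  shows "Yextend \<iota> v 1 = 1"
    and "Yextend \<iota> v (Poly_Mapping.single 0 c) = \<iota> c"
    and "Yextend \<iota> v (p + q) = Yextend \<iota> v p + Yextend \<iota> v q"
    and "Yextend \<iota> v (p * q) = Yextend \<iota> v p * Yextend \<iota> v q"
    and "n \<ge> 2 \<Longrightarrow> Yextend \<iota> v (Ygen n) = v n"
proof -
  note S = Yextend_single[where \<iota>=\<iota>, OF assms(1)] and A = Yextend_add[where \<iota>=\<iota>, OF assms(1,3)]
  show "Yextend \<iota> v (Poly_Mapping.single 0 c) = \<iota> c" by (simp add: S)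
  show "Yextend \<iota> v 1 = 1" by (simp flip: single_one add: S assms)
  show "Yextend \<iota> v (p + q) = Yextend \<iota> v p + Yextend \<iota> v q" by (rule A)
  show "n \<ge> 2 \<Longrightarrow> Yextend \<iota> v (Ygen n) = v n"
    by (auto simp: Ygen_def S assms le_iff_add)
  have 0: "Yextend \<iota> v 0 = 0" by (simp add: Yextend_def)
  have 1: "Yextend \<iota> v (Poly_Mapping.single m c * q) =
      Yextend \<iota> v (Poly_Mapping.single m c) * Yextend \<iota> v q" for m c q
  proof (induction q rule: poly_mapping_induct)
    case (single k d)
    then show ?case
      by (simp add: mult_single S monomial_value_add assms(4) mult_ac del: add_2_eq_Suc')
  next
    case (sum f g)
    then show ?case by (simp add: distrib_left A)
  qed
  show "Yextend \<iota> v (p * q) = Yextend \<iota> v p * Yextend \<iota> v q"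
  proof (induction p rule: poly_mapping_induct)
    case (single k d)
    then show ?case by (simp add: 1)
  next
    case (sum f g)
    then show ?case by (simp add: distrib_right A)
  qed
qed

lemma single_eq_prod_Ygen:
  "(Poly_Mapping.single m 1 :: Yalg) =
     (\<Prod>k\<in>Poly_Mapping.keys m. Ygen (k + 2) ^ Poly_Mapping.lookup m k)"
proof -
  have pow: "(Ygen (k + 2)) ^ e = Poly_Mapping.single (Poly_Mapping.single k e) 1" for k e
    by (induction e) (simp_all add: Ygen_def mult_single single_add[symmetric])
  have prd: "finite S \<Longrightarrow> (\<Prod>k\<in>S. Poly_Mapping.single (g k) 1 :: Yalg) =
      Poly_Mapping.single (\<Sum>k\<in>S. g k) 1" for S and g :: "nat \<Rightarrow> Ymon"
    by (induction rule: finite_induct) (simp_all add: mult_single)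
  have exponents:
    "(\<Sum>k\<in>Poly_Mapping.keys m. Poly_Mapping.single k (Poly_Mapping.lookup m k)) = m"
    by (intro poly_mapping_eqI) (auto simp: lookup_sum lookup_single when_def in_keys_iff)
  show ?thesis
    by (simp only: pow prd finite_keys exponents)
qed

lemma Yextend_unique:
  fixes \<phi> :: "Yalg \<Rightarrow> 'b::comm_ring_1"
  assumes add: "\<And>p q. \<phi> (p + q) = \<phi> p + \<phi> q" and mult: "\<And>p q. \<phi> (p * q) = \<phi> p * \<phi> q"
    and scalars: "\<And>c. \<phi> (Poly_Mapping.single 0 c) = \<iota> c" and one: "\<iota> 1 = 1"
    and gens: "\<And>n. n \<ge> 2 \<Longrightarrow> \<phi> (Ygen n) = v n"
  shows "\<phi> = Yextend \<iota> v"
proof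
  fix p
  have i0: "\<iota> 0 = 0"
    by (metis add scalars add_cancel_right_right single_zero)
  have iadd: "\<iota> (a + b) = \<iota> a + \<iota> b" for a b
    by (metis add scalars single_add)
  have p1: "\<phi> 1 = 1" using scalars[of 1] one by simp
  have ppow: "\<phi> (x ^ e) = \<phi> x ^ e" for x e
    by (induction e) (simp_all add: p1 mult)
  have pprod: "finite S \<Longrightarrow> \<phi> (\<Prod>k\<in>S. g k) = (\<Prod>k\<in>S. \<phi> (g k))" for S and g :: "nat \<Rightarrow> Yalg"
    by (induction rule: finite_induct) (simp_all add: p1 mult)
  show "\<phi> p = Yextend \<iota> v p"
  proof (induction p rule: poly_mapping_induct)
    case (single m c)
    have "Poly_Mapping.single m c = Poly_Mapping.single 0 c * Poly_Mapping.single m 1"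
      by (simp add: mult_single)
    then have "\<phi> (Poly_Mapping.single m c) = \<iota> c * \<phi> (Poly_Mapping.single m 1)"
      by (simp only: mult scalars)
    also have "\<dots> = Yextend \<iota> v (Poly_Mapping.single m c)"
      by (simp only: single_eq_prod_Ygen pprod finite_keys ppow)
        (simp add: gens Yextend_single[where \<iota>=\<iota>, OF i0])
    finally show ?case .
  next
    case (sum f g)
    then show ?case by (simp add: add Yextend_add[where \<iota>=\<iota>, OF i0 iadd])
  qed
qed

lemma tensor_superset:
  assumes "finite S" "Poly_Mapping.keys p \<subseteq> S" "finite T" "Poly_Mapping.keys q \<subseteq> T"
  shows "tensor p q = (\<Sum>m\<in>S. \<Sum>m'\<in>T.
     Poly_Mapping.single (m, m') (Poly_Mapping.lookup p m * Poly_Mapping.lookup q m'))"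
proof -
  have "tensor p q = (\<Sum>m\<in>Poly_Mapping.keys p. \<Sum>m'\<in>T.
     Poly_Mapping.single (m, m') (Poly_Mapping.lookup p m * Poly_Mapping.lookup q m'))"
    unfolding tensor_def using assms
    by (intro sum.cong refl sum.mono_neutral_left) (auto simp: in_keys_iff)
  also have "\<dots> = (\<Sum>m\<in>S. \<Sum>m'\<in>T.
     Poly_Mapping.single (m, m') (Poly_Mapping.lookup p m * Poly_Mapping.lookup q m'))"
    using assms by (intro sum.mono_neutral_left) (auto simp: in_keys_iff)
  finally show ?thesis .
qed

lemma tensor_add_left: "tensor (p + p') q = tensor p q + tensor p' q"
proof -
  have "Poly_Mapping.keys (p + p') \<subseteq> Poly_Mapping.keys p \<union> Poly_Mapping.keys p'"
    by (rule Poly_Mapping.keys_add)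
  then show ?thesis
    by (simp add: tensor_superset[where S="Poly_Mapping.keys p \<union> Poly_Mapping.keys p'"
          and T="Poly_Mapping.keys q"] lookup_add distrib_right single_add sum.distrib)
qed

lemma tensor_add_right: "tensor p (q + q') = tensor p q + tensor p q'"
proof -
  have "Poly_Mapping.keys (q + q') \<subseteq> Poly_Mapping.keys q \<union> Poly_Mapping.keys q'"
    by (rule Poly_Mapping.keys_add)
  then show ?thesis
    by (simp add: tensor_superset[where T="Poly_Mapping.keys q \<union> Poly_Mapping.keys q'"
          and S="Poly_Mapping.keys p"] lookup_add distrib_left single_add sum.distrib)
qed

lemma tensor_single:
  "tensor (Poly_Mapping.single m a) (Poly_Mapping.single m' b) =
     Poly_Mapping.single (m, m') (a * b)"
  by (subst tensor_superset[where S="{m}" and T="{m'}"]) (auto simp: lookup_single)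

lemma tensor_mult: "tensor p q * tensor p' q' = tensor (p * p') (q * q')"
proof (induction p rule: poly_mapping_induct)
  case p: (single k d)
  show ?case
  proof (induction q rule: poly_mapping_induct)
    case q: (single k' d')
    show ?case
    proof (induction p' rule: poly_mapping_induct)
      case p': (single l e)
      show ?case
      proof (induction q' rule: poly_mapping_induct)
        case q': (single l' e')
        show ?case by (simp add: tensor_single mult_single mult_ac)
      qed (simp add: distrib_left tensor_add_right)
    qed (simp add: distrib_left tensor_add_left)
  qed (simp add: distrib_right tensor_add_right)
qed (simp add: distrib_right tensor_add_left)

lemma tensor_functional_superset:
  assumes "finite S" "Poly_Mapping.keys t \<subseteq> S"
  shows "tensor_functional \<xi> \<eta> t = (\<Sum>(m, m')\<in>S. Poly_Mapping.lookup t (m, m') *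
     (\<xi> (Poly_Mapping.single m 1) * \<eta> (Poly_Mapping.single m' 1)))"
  unfolding tensor_functional_def using assms
  by (intro sum.mono_neutral_left) (auto simp: in_keys_iff)

lemma tensor_functional_add:
  "tensor_functional \<xi> \<eta> (s + t) = tensor_functional \<xi> \<eta> s + tensor_functional \<xi> \<eta> t"
proof -
  let ?S = "Poly_Mapping.keys s \<union> Poly_Mapping.keys t"
  have "Poly_Mapping.keys (s + t) \<subseteq> ?S" by (rule Poly_Mapping.keys_add)
  then show ?thesis
    by (simp add: tensor_functional_superset[where S="?S"] lookup_add distrib_right
        sum.distrib case_prod_unfold)
qed

lemma tensor_functional_tensor:
  assumes \<xi>: "\<And>p q. \<xi> (p + q) = \<xi> p + \<xi> q" "\<And>c p. \<xi> (Poly_Mapping.single 0 c * p) = c * \<xi> p"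
    and \<eta>: "\<And>p q. \<eta> (p + q) = \<eta> p + \<eta> q" "\<And>c p. \<eta> (Poly_Mapping.single 0 c * p) = c * \<eta> p"
  shows "tensor_functional \<xi> \<eta> (tensor p q) = \<xi> p * \<eta> q"
proof (induction p rule: poly_mapping_induct)
  case p: (single m a)
  show ?case
  proof (induction q rule: poly_mapping_induct)
    case q: (single m' b)
    have "\<xi> (Poly_Mapping.single m a) = a * \<xi> (Poly_Mapping.single m 1)"
      "\<eta> (Poly_Mapping.single m' b) = b * \<eta> (Poly_Mapping.single m' 1)"
      using \<xi>(2)[of a "Poly_Mapping.single m 1"] \<eta>(2)[of b "Poly_Mapping.single m' 1"]
      by (simp_all add: mult_single)
    then show ?case
      by (simp add: tensor_single tensor_functional_superset[where S="{(m, m')}"]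
          lookup_single mult_ac)
  qed (simp add: tensor_add_right tensor_functional_add \<eta> distrib_left)
qed (simp add: tensor_add_left tensor_functional_add \<xi> distrib_right)

lemma S_transform_nth_0: "fps_nth (S_transform \<mu>) 0 = 1"
proof -
  have "fps_inv (moment_series \<mu>) $ 0 = 0" "fps_inv (moment_series \<mu>) $ Suc 0 = 1"
    by (simp_all add: fps_inv_def moment_series_def)
  then show ?thesis
    by (simp add: S_transform_def fps_divide_def fps_mult_nth)
qed

end

theory Submission
  imports Defs
begin

text \<open>Write $S = S_\mu$. The moment-cumulant formula gives $R_\mu = (z S)^{\langle-1\rangle}$, so
$\chi_\mu$ is the character whose value on $Y_n$ is the coefficient of $z^n$ in
$(z S)^{\langle-1\rangle}$. The coproduct of $\mathcal{Y}^{(1)}$ is the one for which convolution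
of characters multiplies these series: the character of $S$ times that of $T$ is the
character of $S T$ (lemma \<open>convolution_S_inverse\<close>). Hence the $j$-th convolution power
of $\chi_\mu$ is the character of $S^j$, and by Lagrange inversion its value on $Y_n$ is
$\frac1n [z^{n-1}] (S^{-n})^j$, which is linear in the $j$-th power of one fixed series.
Expanding $(\varepsilon - \chi_\mu)^k$ binomially therefore gives
$(\varepsilon - \chi_\mu)^k(Y_n) = \frac1n [z^{n-1}] (1 - S^{-n})^k$, and summation over $k$ gives
$$(\log \chi_\mu)(Y_n) = \tfrac1n [z^{n-1}] \log (S^{-n}) = - [z^{n-1}] \log S.$$

The multiplicativity of $S$ is proved with binary trees. Label the nodes of a tree with $n$
nodes by $1, \dots, n$ in symmetric order (left subtree, node, right subtree). The maximal
chains of left children are the blocks of a non-crossing partition $\pi$, every $\pi \in NC(n)$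
arises exactly once in this way, and the maximal chains of right children are the blocks of
$K(\pi)$. Indeed, following $P_{K(\pi)}$ and then $P_\pi$ moves from each node to its successor in
symmetric order (lemmas \<open>Kreweras_left_blocks\<close> and \<open>bij_betw_left_blocks\<close>). A weight that is a
product over the blocks of $\pi$ and of $K(\pi)$ thus becomes a product over chains, which the
splitting of a tree at its root respects. The generating series $1 + h$ of all trees then
satisfies $1 + h = f \circ u = g \circ v$ and $z h = u v$ for two auxiliary series $u$ and $v$, where
$f = 1 + (z S)^{\langle-1\rangle}$ and $g = 1 + (z T)^{\langle-1\rangle}$ encode the weights. So
$u = h \cdot S(h)$ and $v = h \cdot T(h)$, hence $z = h \cdot S(h) T(h)$, that is
$h = (z S T)^{\langle-1\rangle}$ (lemma \<open>tree_series_S_multiplicative\<close>). The moment-cumulant formula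
is the special case in which the blocks of $K(\pi)$ have weight $1$, where $T = 1/(1+z)$.\<close>


section \<open>Lagrange inversion and the logarithm of a power series\<close>

text \<open>Up to degree $m$ only the powers of \<open>b\<close> up to the $m$-th contribute, so multiplication by \<open>c\<close> may be
carried out under the finite sum.\<close>

lemma fps_compose_mult_nth:
  fixes a b c :: "'a::comm_ring_1 fps"
  assumes "b $ 0 = 0"
  shows "((a oo b) * c) $ m = (\<Sum>i\<le>m. a $ i * (b ^ i * c) $ m)"
proof -
  have compose: "(a oo b) $ j = (\<Sum>i\<le>m. a $ i * (b ^ i) $ j)" if "j \<le> m" for j
    unfolding fps_compose_nth atLeast0AtMost using that startsby_zero_power_prefix[OF assms]
    by (intro sum.mono_neutral_left) auto
  have "((a oo b) * c) $ m = (\<Sum>j\<le>m. (\<Sum>i\<le>m. a $ i * (b ^ i) $ j) * c $ (m - j))"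
    by (simp add: fps_mult_nth atLeast0AtMost compose)
  also have "\<dots> = (\<Sum>i\<le>m. \<Sum>j\<le>m. a $ i * (b ^ i) $ j * c $ (m - j))"
    unfolding sum_distrib_right by (rule sum.swap)
  also have "\<dots> = (\<Sum>i\<le>m. a $ i * (b ^ i * c) $ m)"
    by (simp add: fps_mult_nth atLeast0AtMost sum_distrib_left mult.assoc)
  finally show ?thesis .
qed

text \<open>With $F = z P$, $G = F^{\langle-1\rangle}$ and $Q = 1/P$, the derivative of $G(F) = z$ is
$1 = G'(F) F'$. Multiplying by $Q^{n+1}$ and comparing coefficients of $z^n$ leaves a sum of the
terms $[z^n] F^i F' Q^{n+1}$ weighted by the coefficients of $G'$. In Laurent series such a term is
the residue of $F^{i-n-1} F'$, which is an exact derivative unless $i = n$. The proof performs this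
residue computation within power series.\<close>

lemma Lagrange_inversion:
  fixes P :: "'a::field_char_0 fps"
  assumes P0: "P $ 0 = 1"
  shows "of_nat (Suc n) * fps_inv (fps_X * P) $ Suc n = (inverse P ^ Suc n) $ n"
proof -
  define F where "F = fps_X * P"
  define G where "G = fps_inv F"
  define Q where "Q = inverse P"
  have F0: "F $ 0 = 0" and F1: "F $ 1 \<noteq> 0" by (simp_all add: F_def P0)
  have PQ: "P * Q = 1" unfolding Q_def using P0 by (simp add: inverse_mult_eq_1')
  have Q0: "Q $ 0 = 1" by (simp add: Q_def P0)
  have "1 = fps_deriv (G oo F)" by (simp add: G_def fps_inv[OF F0 F1])
  also have "\<dots> = (fps_deriv G oo F) * fps_deriv F" by (rule fps_compose_deriv[OF F0])
  finally have "Q ^ Suc n $ n = ((fps_deriv G oo F) * (fps_deriv F * Q ^ Suc n)) $ n"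
    by (metis mult.assoc mult_1)
  also have "\<dots> = (\<Sum>i\<le>n. fps_deriv G $ i * (F ^ i * (fps_deriv F * Q ^ Suc n)) $ n)"
    by (rule fps_compose_mult_nth[OF F0])
  also have "\<dots> = (\<Sum>i\<le>n. if i = n then fps_deriv G $ i else 0)"
  proof (rule sum.cong[OF refl])
    fix i assume "i \<in> {..n}"
    then obtain k where n: "n = i + k" by (auto simp: le_iff_add)
    have QP: "Q ^ Suc n * P ^ i = Q ^ Suc k" 
    proof -
      have "Q ^ Suc n * P ^ i = Q ^ Suc k * (P * Q) ^ i"
        by (simp add: n power_add power_mult_distrib mult_ac)
      then show ?thesis by (simp add: PQ)
    qed
    have "F ^ i * (fps_deriv F * Q ^ Suc n) = fps_X ^ i * (fps_deriv F * (Q ^ Suc n * P ^ i))"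
      by (simp add: F_def power_mult_distrib mult_ac)
    also have "\<dots> = fps_X ^ i * (fps_deriv F * Q ^ Suc k)" by (simp only: QP)
    also have "fps_deriv F * Q ^ Suc k = Q ^ k * (P * Q) + fps_X * (fps_deriv P * Q ^ Suc k)"
      by (simp add: F_def algebra_simps)
    also have "\<dots> = Q ^ k + fps_X * (fps_deriv P * Q ^ Suc k)" by (simp add: PQ)
    finally have "(F ^ i * (fps_deriv F * Q ^ Suc n)) $ n = 
        (Q ^ k + fps_X * (fps_deriv P * Q ^ Suc k)) $ k"
      by (simp add: n fps_X_power_mult_nth)
    \<comment> \<open>By $(Q^k)' = -k Q^{k+1} P'$ the series is $Q^k - \frac1k z (Q^k)'$ for $k > 0$, where the terms
      of degree $k$ cancel.\<close>
    also have "\<dots> = (if k = 0 then 1 else 0)"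
    proof (cases k)
      case 0
      then show ?thesis by simp
    next
      case (Suc l)
      have "fps_deriv (Q ^ Suc l) = - of_nat (Suc l) * (fps_deriv P * Q ^ Suc (Suc l))"
      proof -
        have "fps_deriv Q = - fps_deriv P * Q\<^sup>2"
          unfolding Q_def by (rule fps_inverse_deriv) (simp add: P0)
        then show ?thesis
          by (simp only: fps_deriv_power') (simp add: power2_eq_square algebra_simps)
      qed
      then have "of_nat (Suc l) * (Q ^ Suc l) $ Suc l =
          - of_nat (Suc l) * (fps_deriv P * Q ^ Suc (Suc l)) $ l"
        by (metis (no_types, lifting) Suc_eq_plus1 fps_deriv_nth fps_mult_left_const_nth fps_neg_nth
            fps_of_nat mult_minus_left)
      then have "of_nat (Suc l) * ((Q ^ Suc l) $ Suc l + (fps_deriv P * Q ^ Suc (Suc l)) $ l) = 0"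
        by (simp add: distrib_left del: of_nat_Suc)
      then have "(Q ^ Suc l) $ Suc l + (fps_deriv P * Q ^ Suc (Suc l)) $ l = 0"
        by (metis mult_eq_0_iff of_nat_eq_0_iff nat.distinct(1))
      then show ?thesis by (simp add: Suc del: power_Suc)
    qed
    finally show "fps_deriv G $ i * (F ^ i * (fps_deriv F * Q ^ Suc n)) $ n =
        (if i = n then fps_deriv G $ i else 0)" by (simp add: n)
  qed
  also have "\<dots> = of_nat (Suc n) * G $ Suc n" by (simp)
  finally show ?thesis by (simp add: G_def F_def Q_def)
qed

text \<open>The $k$-th term of the logarithm starts in degree $k$, so every truncation after at least $n$ terms
is exact in degree $n$.\<close>

lemma fps_log_nth:
  assumes "f $ 0 = 1" "n \<le> N"
  shows "fps_log f $ n = - (\<Sum>k<N. ((1 - f) ^ Suc k) $ n / of_nat (Suc k))"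
proof -
  define t where "t k = fps_const (1 / of_nat (Suc k)) * (1 - f) ^ Suc k" for k
  have t0: "t k $ n = 0" if "n \<le> k" for n k
    using startsby_zero_power_prefix[of "1 - f" "Suc k"] that assms(1) by (simp add: t_def del: power_Suc)
  have "t sums Abs_fps (\<lambda>n. \<Sum>k<n. t k $ n)"
    unfolding sums_def
  proof (rule tendsto_fpsI)
    fix n
    have "(\<Sum>k<N. t k) $ n = (\<Sum>k<n. t k $ n)" if "n \<le> N" for N
      unfolding fps_sum_nth using that t0 by (intro sum.mono_neutral_right) auto
    then show "\<forall>\<^sub>F N in sequentially. (\<Sum>k<N. t k) $ n = Abs_fps (\<lambda>n. \<Sum>k<n. t k $ n) $ n"
      by (auto simp: eventually_sequentially)
  qed
  then have "suminf t = Abs_fps (\<lambda>n. \<Sum>k<n. t k $ n)" by (rule sums_unique[symmetric])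
  then have "fps_log f $ n = - (\<Sum>k<n. t k $ n)" by (simp add: fps_log_def t_def[abs_def])
  also have "(\<Sum>k<n. t k $ n) = (\<Sum>k<N. t k $ n)"
    using assms(2) t0 by (intro sum.mono_neutral_left) auto
  finally show ?thesis by (simp add: t_def del: power_Suc of_nat_Suc)
qed

lemma fps_log_eq_ln_compose:
  assumes "f $ 0 = 1"
  shows "fps_log f = fps_ln 1 oo (f - 1)"
proof (rule fps_ext)
  fix n
  have "(fps_ln 1 oo (f - 1)) $ n = (\<Sum>k\<in>{..<Suc n}. fps_ln 1 $ k * ((f - 1) ^ k) $ n)"
    by (simp add: fps_compose_nth atLeast0AtMost lessThan_Suc_atMost)
  also have "\<dots> = (\<Sum>k<n. fps_ln 1 $ Suc k * ((f - 1) ^ Suc k) $ n)"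
    by (subst sum.lessThan_Suc_shift) simp
  also have "\<dots> = (\<Sum>k<n. - (((1 - f) ^ Suc k) $ n / of_nat (Suc k)))"
  proof (rule sum.cong[OF refl])
    fix k
    have "(1 - f) ^ Suc k = (- 1) ^ Suc k * (f - 1) ^ Suc k"
      by (metis minus_diff_eq power_minus)
    also have "(- 1 :: complex fps) ^ Suc k = fps_const ((- 1) ^ Suc k)"
      by (metis fps_const_1_eq_1 fps_const_neg fps_const_power)
    finally show "fps_ln 1 $ Suc k * ((f - 1) ^ Suc k) $ n = - (((1 - f) ^ Suc k) $ n / of_nat (Suc k))"
      by (simp add: fps_ln_nth del: power_Suc of_nat_Suc) simp
  qed
  also have "\<dots> = fps_log f $ n"
    by (simp add: fps_log_nth[OF assms order_refl] sum_negf)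
  finally show "fps_log f $ n = (fps_ln 1 oo (f - 1)) $ n" ..
qed

lemma fps_deriv_log:
  assumes "f $ 0 = 1"
  shows "fps_deriv (fps_log f) = inverse f * fps_deriv f"
proof -
  have "fps_deriv (fps_log f) = (inverse (1 + fps_X) oo (f - 1)) * fps_deriv f"
    using assms by (simp add: fps_log_eq_ln_compose fps_compose_deriv fps_ln_deriv)
  also have "inverse (1 + fps_X) oo (f - 1) = inverse f"
    using assms by (simp add: fps_inverse_compose fps_compose_add_distrib)
  finally show ?thesis .
qed

text \<open>Both sides have constant term $0$ and the same logarithmic derivative.\<close>

lemma fps_log_inverse_power:
  assumes "f $ 0 = 1"
  shows "fps_log (inverse f ^ n) = - fps_const (of_nat n) * fps_log f"
proof -
  have 0: "(inverse f ^ n) $ 0 = 1" by (simp add: fps_power_zeroth assms)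
  have d: "fps_deriv (inverse f ^ n) = - fps_const (of_nat n) * (inverse f * fps_deriv f) * inverse f ^ n"
  proof (cases n)
    case (Suc m)
    have "fps_deriv (inverse f) = - fps_deriv f * (inverse f)\<^sup>2"
      by (rule fps_inverse_deriv) (simp add: assms)
    then show ?thesis
      unfolding Suc by (simp only: fps_deriv_power' fps_of_nat)
        (simp add: power2_eq_square algebra_simps)
  qed simp
  have "fps_deriv (fps_log (inverse f ^ n)) = inverse (inverse f ^ n) * fps_deriv (inverse f ^ n)"
    by (rule fps_deriv_log[OF 0])
  also have "\<dots> = - fps_const (of_nat n) * (inverse f * fps_deriv f) * 
      (inverse (inverse f ^ n) * inverse f ^ n)"
    unfolding d by (simp add: mult_ac)
  also have "inverse (inverse f ^ n) * inverse f ^ n = 1"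
    by (rule inverse_mult_eq_1) (simp only: 0, simp)
  also have "- fps_const (of_nat n) * (inverse f * fps_deriv f) * 1 = 
      fps_deriv (- fps_const (of_nat n) * fps_log f)"
    by (simp add: fps_deriv_log[OF assms])
  finally show ?thesis
    unfolding fps_deriv_eq_iff using assms fps_log_nth[OF assms le0, of 0] fps_log_nth[OF 0 le0, of 0] by simp
qed

section \<open>Series of weighted binary trees\<close>

datatype bintree = Leaf | Node bintree bintree

primrec mirror :: "bintree \<Rightarrow> bintree" where
  "mirror Leaf = Leaf"
| "mirror (Node l r) = Node (mirror r) (mirror l)"

primrec left_length :: "bintree \<Rightarrow> nat" where
  "left_length Leaf = 0"
| "left_length (Node l r) = Suc (left_length l)"

text \<open>The product of the weights of all maximal left chains that do not start at the root. Such a chain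
starts at a right child. The value \<open>f 0\<close> is used for empty right subtrees; in the applications
it is $1$.\<close>

primrec inner_weight :: "(nat \<Rightarrow> 'a::comm_monoid_mult) \<Rightarrow> bintree \<Rightarrow> 'a" where
  "inner_weight f Leaf = 1"
| "inner_weight f (Node l r) = inner_weight f l * (f (left_length r) * inner_weight f r)"

abbreviation right_length :: "bintree \<Rightarrow> nat" where
  "right_length t \<equiv> left_length (mirror t)"

text \<open>The two chains through the root get their own weight functions \<open>p\<close> (left) and \<open>q\<close> (right),
because in a subtree they are only parts of chains of the whole tree: passing to the whole tree
makes one of them longer by one node.\<close>

definition chain_weight ::
  "(nat \<Rightarrow> 'a::comm_monoid_mult) \<Rightarrow> (nat \<Rightarrow> 'a) \<Rightarrow> (nat \<Rightarrow> 'a) \<Rightarrow> (nat \<Rightarrow> 'a) \<Rightarrow> bintree \<Rightarrow> 'a" where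
  "chain_weight p f q g t = p (left_length t) * inner_weight f t *
     (q (right_length t) * inner_weight g (mirror t))"

definition trees :: "nat \<Rightarrow> bintree set" where
  "trees n = {t. size t = n}"

definition tree_series :: "(bintree \<Rightarrow> 'a::comm_ring_1) \<Rightarrow> 'a fps" where
  "tree_series F = Abs_fps (\<lambda>n. \<Sum>t\<in>trees n. F t)"

lemma mirror_mirror [simp]: "mirror (mirror t) = t"
  by (induction t) auto

lemma size_mirror [simp]: "size (mirror t) = size t"
  by (induction t) auto

lemma left_length_le_size: "left_length t \<le> size t"
  by (induction t) auto

lemma trees_0: "trees 0 = {Leaf}"
proof -
  have "size t = 0 \<longleftrightarrow> t = Leaf" for t :: bintree by (cases t) auto
  then show ?thesis by (auto simp: trees_def)
qed

lemma bij_betw_Node: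
  "bij_betw (\<lambda>(i, l, r). Node l r) (SIGMA i:{..n}. trees i \<times> trees (n - i)) (trees (Suc n))"
proof (rule bij_betw_byWitness[where f'="\<lambda>t. case t of Node l r \<Rightarrow> (size l, l, r)"])
  show "(\<lambda>t. case t of Node l r \<Rightarrow> (size l, l, r)) ` trees (Suc n)
      \<subseteq> (SIGMA i:{..n}. trees i \<times> trees (n - i))"
  proof clarify
    fix t i l r assume "t \<in> trees (Suc n)" "(i, l, r) = (case t of Node l r \<Rightarrow> (size l, l, r))"
    then show "i \<in> {..n} \<and> (l, r) \<in> trees i \<times> trees (n - i)"
      by (cases t) (auto simp: trees_def)
  qed
  show "\<forall>t\<in>trees (Suc n). (\<lambda>(i, l, r). Node l r) (case t of Node l r \<Rightarrow> (size l, l, r)) = t"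
  proof
    fix t assume "t \<in> trees (Suc n)"
    then show "(\<lambda>(i, l, r). Node l r) (case t of Node l r \<Rightarrow> (size l, l, r)) = t"
      by (cases t) (auto simp: trees_def)
  qed
qed (auto simp: trees_def)

lemma finite_trees [simp]: "finite (trees n)"
proof (induction n rule: less_induct)
  case (less n)
  show ?case
  proof (cases n)
    case (Suc m)
    have "finite (SIGMA i:{..m}. trees i \<times> trees (m - i))"
      using less by (intro finite_SigmaI finite_cartesian_product) (auto simp: Suc)
    then show ?thesis using bij_betw_finite[OF bij_betw_Node] by (simp add: Suc)
  qed (simp add: trees_0)
qed

lemma sum_trees_Suc:
  "(\<Sum>t\<in>trees (Suc n). F t) = (\<Sum>i\<le>n. \<Sum>l\<in>trees i. \<Sum>r\<in>trees (n - i). F (Node l r))"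
  by (simp add: sum.reindex_bij_betw[OF bij_betw_Node, symmetric] sum.Sigma sum.cartesian_product
      case_prod_unfold)

lemma tree_series_nth [simp]: "tree_series F $ n = (\<Sum>t\<in>trees n. F t)"
  by (simp add: tree_series_def)

lemma tree_series_Node:
  assumes "\<And>l r. F (Node l r) = u l * v r"
  shows "tree_series F = fps_const (F Leaf) + fps_X * (tree_series u * tree_series v)"
proof (rule fps_ext)
  fix n
  show "tree_series F $ n = (fps_const (F Leaf) + fps_X * (tree_series u * tree_series v)) $ n"
  proof (cases n)
    case (Suc m)
    have "(tree_series u * tree_series v) $ m = tree_series F $ n"
      by (simp add: Suc sum_trees_Suc assms fps_mult_nth sum_product atLeast0AtMost)
    then show ?thesis by (simp add: Suc)
  qed (simp add: trees_0)
qed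

lemma tree_series_mirror: "tree_series (\<lambda>t. F (mirror t)) = tree_series F"
proof (rule fps_ext)
  fix n
  have "bij_betw mirror (trees n) (trees n)"
    by (rule bij_betw_byWitness[where f'=mirror]) (auto simp: trees_def)
  then show "tree_series (\<lambda>t. F (mirror t)) $ n = tree_series F $ n"
    by (simp add: sum.reindex_bij_betw)
qed

text \<open>The left chain through the root continues in \<open>l\<close>, and its length drops by one there; the
right chain of \<open>l\<close> is a maximal chain of the whole tree. For \<open>r\<close> the roles are exchanged.\<close>

lemma chain_weight_Node:
  "chain_weight p f q g (Node l r) =
     chain_weight (p \<circ> Suc) f g g l * chain_weight f f (q \<circ> Suc) g r"
  by (simp add: chain_weight_def mult_ac)

lemma tree_series_chain_weight:
  fixes p f q g :: "nat \<Rightarrow> 'a::comm_ring_1"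
  shows "tree_series (chain_weight p f q g) = fps_const (p 0 * q 0) +
    fps_X * (tree_series (chain_weight (p \<circ> Suc) f g g) * tree_series (chain_weight f f (q \<circ> Suc) g))"
  using tree_series_Node[where F="chain_weight p f q g", OF chain_weight_Node]
  by (simp only:) (simp add: chain_weight_def[where t=Leaf])

lemma chain_weight_mirror: "chain_weight p f q g (mirror t) = chain_weight q g p f t"
  by (simp add: chain_weight_def mult_ac)

text \<open>Removing the root together with its right subtree shortens the left chain by one, and the removed
part contributes a factor that does not depend on the length of the chain.\<close>

lemma tree_series_left_length:
  fixes f g :: "nat \<Rightarrow> 'a::comm_ring_1"
  assumes "g 0 = 1"
  shows "tree_series (chain_weight (\<lambda>j. if j = k then 1 else 0) f g g) =
    (fps_X * tree_series (chain_weight f f (g \<circ> Suc) g)) ^ k"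
proof (induction k)
  case 0
  have "tree_series (chain_weight (\<lambda>j. if j = 0 then 1 else 0) f g g) $ n = 1 $ n" for n
  proof (cases n)
    case (Suc m)
    have "chain_weight (\<lambda>j. if j = 0 then 1 else 0) f g g t = 0" if "t \<in> trees n" for t
      using that by (cases t) (auto simp: trees_def Suc chain_weight_def)
    then show ?thesis by (simp add: Suc)
  qed (simp add: trees_0 chain_weight_def assms)
  then show ?case by (intro fps_ext) simp
next
  case (Suc k)
  have shift: "(\<lambda>j. if j = Suc k then 1 else 0) \<circ> Suc = (\<lambda>j. if j = k then 1 else 0 :: 'a)"
    by auto
  have "tree_series (chain_weight (\<lambda>j. if j = Suc k then 1 else 0) f g g) =
      fps_X * (tree_series (chain_weight (\<lambda>j. if j = k then 1 else 0) f g g) *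
        tree_series (chain_weight f f (g \<circ> Suc) g))"
    by (subst tree_series_chain_weight) (simp add: shift)
  then show ?case by (simp only: Suc power_Suc mult_ac)
qed

lemma tree_series_compose:
  fixes f g p :: "nat \<Rightarrow> 'a::comm_ring_1"
  assumes "g 0 = 1"
  shows "tree_series (chain_weight p f g g) =
    Abs_fps p oo (fps_X * tree_series (chain_weight f f (g \<circ> Suc) g))"
proof (rule fps_ext)
  fix n
  let ?\<delta> = "\<lambda>k j. if j = k then 1 else 0 :: 'a"
  have "chain_weight p f g g t = (\<Sum>k\<le>n. p k * chain_weight (?\<delta> k) f g g t)" if "t \<in> trees n" for t
  proof -
    have "left_length t \<le> n" using that left_length_le_size[of t] by (simp add: trees_def)
    then have "p (left_length t) = (\<Sum>k\<le>n. p k * ?\<delta> k (left_length t))"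
      by (simp add: if_distrib cong: if_cong)
    then show ?thesis by (simp add: chain_weight_def sum_distrib_right mult.assoc)
  qed
  then have "tree_series (chain_weight p f g g) $ n =
      (\<Sum>t\<in>trees n. \<Sum>k\<le>n. p k * chain_weight (?\<delta> k) f g g t)" by simp
  also have "\<dots> = (\<Sum>k\<le>n. p k * tree_series (chain_weight (?\<delta> k) f g g) $ n)"
    by (subst sum.swap) (simp add: sum_distrib_left)
  finally show "tree_series (chain_weight p f g g) $ n =
      (Abs_fps p oo (fps_X * tree_series (chain_weight f f (g \<circ> Suc) g))) $ n"
    by (simp only: tree_series_left_length[where g=g, OF assms] fps_compose_nth fps_nth_Abs_fps atLeast0AtMost)
qed

text \<open>Let $u$ be the weighted sum over all trees that consist of a root without left subtree and an
arbitrary right subtree, where the left chain of the root itself gets no weight, and let $v$ be its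
mirror image. A tree is a left chain of such pieces, and the length of the chain determines the
remaining factor; hence $1 + h = f \circ u$, and by mirror symmetry $1 + h = g \circ v$. Splitting a
nonempty tree at its root gives $z h = u v$. Eliminating $u$ and $v$ leaves $z = h \cdot S(h) T(h)$.\<close>

theorem tree_series_S_multiplicative:
  fixes f g :: "nat \<Rightarrow> 'a::field" and S T :: "'a fps"
  assumes f: "Abs_fps f = 1 + fps_inv (fps_X * S)" and S: "S $ 0 = 1"
    and g: "Abs_fps g = 1 + fps_inv (fps_X * T)" and T: "T $ 0 = 1"
  shows "tree_series (chain_weight f f g g) = 1 + fps_inv (fps_X * (S * T))"
proof -
  have inv0: "fps_inv F $ 0 = 0" for F :: "'a fps" by (simp add: fps_inv_def)
  have inv1: "fps_inv (fps_X * F) $ 1 = 1" if "F $ 0 = 1" for F :: "'a fps"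
    using that by (simp add: fps_inv_def)
  have f0: "f 0 = 1" and f1: "f 1 = 1" and g0: "g 0 = 1" and g1: "g 1 = 1"
    using arg_cong[OF f, of "\<lambda>F. F $ 0"] arg_cong[OF f, of "\<lambda>F. F $ 1"]
      arg_cong[OF g, of "\<lambda>F. F $ 0"] arg_cong[OF g, of "\<lambda>F. F $ 1"]
    by (simp_all add: inv0 inv1[unfolded One_nat_def] S T)
  define h where "h = tree_series (chain_weight f f g g) - 1"
  define u where "u = fps_X * tree_series (chain_weight f f (g \<circ> Suc) g)"
  define v where "v = fps_X * tree_series (chain_weight (f \<circ> Suc) f g g)"
  have [simp]: "u $ 0 = 0" "v $ 0 = 0" by (simp_all add: u_def v_def)
  have h0 [simp]: "h $ 0 = 0" by (simp add: h_def trees_0 chain_weight_def f0 g0)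
  have "h = fps_X * (tree_series (chain_weight (f \<circ> Suc) f g g) *
      tree_series (chain_weight f f (g \<circ> Suc) g))"
    unfolding h_def by (subst tree_series_chain_weight) (simp add: f0 g0)
  then have Xh: "fps_X * h = u * v" and h1: "h $ 1 = 1"
    by (simp_all add: u_def v_def trees_0 chain_weight_def f0 f1[simplified] g0 g1[simplified] mult_ac)
  have cancel: "w = F * h" if "1 + h = (1 + fps_inv G) oo w" "w $ 0 = 0" "G = fps_X * H" 
     "H $ 0 = 1" "F = H oo h" for w F G H
  proof -
    have "h = fps_inv G oo w" using that by (simp add: fps_compose_add_distrib)
    then have "G oo h = (G oo fps_inv G) oo w" using that by (simp add: fps_compose_assoc inv0)
    also have "G oo fps_inv G = fps_X" using that by (intro fps_inv_right) auto
    finally have "w = G oo h" using that by simp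
    then show ?thesis using that by (simp add: fps_compose_mult_distrib mult.commute)
  qed
  have "1 + h = (1 + fps_inv (fps_X * S)) oo u"
    unfolding f[symmetric] u_def h_def by (simp add: tree_series_compose[where g=g, OF g0])
  then have u: "u = (S oo h) * h" by (rule cancel) (simp_all add: S)
  have "1 + h = tree_series (chain_weight g g f f)"
    unfolding h_def using tree_series_mirror[of "chain_weight g g f f"]
    by (simp add: chain_weight_mirror)
  also have "\<dots> = Abs_fps g oo (fps_X * tree_series (chain_weight g g (f \<circ> Suc) f))"
    by (rule tree_series_compose[where g=f, OF f0])
  also have "tree_series (chain_weight g g (f \<circ> Suc) f) = tree_series (chain_weight (f \<circ> Suc) f g g)"
    using tree_series_mirror[of "chain_weight g g (f \<circ> Suc) f"] by (simp add: chain_weight_mirror)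
  finally have "1 + h = (1 + fps_inv (fps_X * T)) oo v" unfolding g v_def .
  then have v: "v = (T oo h) * h" by (rule cancel) (simp_all add: T)
  have "h * fps_X = h * ((fps_X * (S * T)) oo h)"
    using Xh unfolding u v by (simp add: fps_compose_mult_distrib mult_ac)
  moreover have "h \<noteq> 0" using h1 by auto
  ultimately have X: "(fps_X * (S * T)) oo h = fps_X" by simp
  have "fps_inv (fps_X * (S * T)) oo (fps_X * (S * T)) = fps_X"
    by (rule fps_inv) (simp_all add: S T)
  then have "h = (fps_inv (fps_X * (S * T)) oo (fps_X * (S * T))) oo h" by simp
  also have "\<dots> = fps_inv (fps_X * (S * T)) oo fps_X"
    by (subst fps_compose_assoc[symmetric]) (simp_all add: X)
  finally show ?thesis by (simp add: h_def diff_eq_eq add.commute)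
qed

section \<open>Chains of a binary tree as non-crossing partitions\<close>

text \<open>The labels on the left chain through the root, where the nodes are labelled in symmetric order
starting with \<open>s\<close>. The root then carries the label \<open>s + size l\<close>.\<close>

primrec left_spine :: "bintree \<Rightarrow> nat \<Rightarrow> nat set" where
  "left_spine Leaf s = {}"
| "left_spine (Node l r) s = insert (s + size l) (left_spine l s)"

text \<open>The label sets of all maximal left chains: the chain of the root extends the one of \<open>l\<close>.\<close>

primrec left_blocks :: "bintree \<Rightarrow> nat \<Rightarrow> nat set set" where
  "left_blocks Leaf s = {}"
| "left_blocks (Node l r) s =
     insert (insert (s + size l) (left_spine l s)) (left_blocks l s - {left_spine l s}) \<union>
     left_blocks r (Suc (s + size l))"

primrec right_spine :: "bintree \<Rightarrow> nat \<Rightarrow> nat set" where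
  "right_spine Leaf s = {}"
| "right_spine (Node l r) s = insert (s + size l) (right_spine r (Suc (s + size l)))"

primrec right_blocks :: "bintree \<Rightarrow> nat \<Rightarrow> nat set set" where
  "right_blocks Leaf s = {}"
| "right_blocks (Node l r) s =
     insert (insert (s + size l) (right_spine r (Suc (s + size l))))
       (right_blocks r (Suc (s + size l)) - {right_spine r (Suc (s + size l))}) \<union>
     right_blocks l s"

lemma partition_on_disjointD:
  assumes "partition_on A P" "B \<in> P" "C \<in> P" "x \<in> B" "x \<in> C"
  shows "B = C"
  using assms by (auto simp: partition_on_def disjoint_def)

lemma partition_on_memD:
  assumes "partition_on A P" "B \<in> P" "x \<in> B"
  shows "x \<in> A"
  using assms by (auto simp: partition_on_def)

text \<open>This is the situation at the root \<open>m\<close> of a tree, whose chain extends the chain \<open>V\<close> of one subtree.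
The case \<open>V = {}\<close> is that of an empty subtree.\<close>

lemma partition_on_glue:
  assumes P: "partition_on A P" and Q: "partition_on B Q" and "A \<inter> B = {}"
    and "m \<notin> A" "m \<notin> B" and V: "V \<in> P \<or> V = {}"
  shows "partition_on (insert m (A \<union> B)) (insert (insert m V) (P - {V}) \<union> Q)"
proof (rule partition_onI)
  have VA: "V \<subseteq> A" using V P by (auto simp: partition_on_def)
  have PA: "U \<subseteq> A" if "U \<in> P" for U using that P by (auto simp: partition_on_def)
  have QB: "U \<subseteq> B" if "U \<in> Q" for U using that Q by (auto simp: partition_on_def)
  have UP: "\<Union>P = A" and UQ: "\<Union>Q = B" using P Q by (auto simp: partition_on_def)
  have "\<Union>(P - {V}) \<union> V = \<Union>P" using V by auto
  then show "\<Union>(insert (insert m V) (P - {V}) \<union> Q) = insert m (A \<union> B)"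
    using UP UQ by auto
  show "{} \<notin> insert (insert m V) (P - {V}) \<union> Q"
    using P Q by (auto simp: partition_on_def)
  have dP: "U \<inter> W = {}" if "U \<in> P" "W \<in> P" "U \<noteq> W" for U W
    using partition_on_disjointD[OF P] that by blast
  have dQ: "U \<inter> W = {}" if "U \<in> Q" "W \<in> Q" "U \<noteq> W" for U W
    using partition_on_disjointD[OF Q] that by blast
  have dV: "U \<inter> insert m V = {}" if "U \<in> P - {V}" for U
    using that V dP[of U V] PA[of U] assms by blast
  have dVQ: "U \<inter> insert m V = {}" if "U \<in> Q" for U
    using that VA QB[of U] assms by blast
  have dPQ: "U \<inter> W = {}" if "U \<in> P" "W \<in> Q" for U W
    using that PA[of U] QB[of W] assms by blast
  fix U W assume "U \<in> insert (insert m V) (P - {V}) \<union> Q" "W \<in> insert (insert m V) (P - {V}) \<union> Q"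
    "U \<noteq> W"
  then consider "U = insert m V" "W \<in> P - {V}" | "U = insert m V" "W \<in> Q"
    | "U \<in> P - {V}" "W = insert m V" | "U \<in> P" "W \<in> P" | "U \<in> P" "W \<in> Q"
    | "U \<in> Q" "W = insert m V" | "U \<in> Q" "W \<in> P" | "U \<in> Q" "W \<in> Q"
    by (metis DiffD1 Un_iff insert_iff)
  then have "U \<inter> W = {}"
  proof cases
    case 1
    then show ?thesis using dV[of W] by blast
  next
    case 2
    then show ?thesis using dVQ[of W] by blast
  next
    case 3
    then show ?thesis using dV[of U] by blast
  next
    case 4
    then show ?thesis using dP[of U W] \<open>U \<noteq> W\<close> by blast
  next
    case 5
    then show ?thesis using dPQ[of U W] by blast
  next
    case 6
    then show ?thesis using dVQ[of U] by blast
  next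
    case 7
    then show ?thesis using dPQ[of W U] by blast
  next
    case 8
    then show ?thesis using dQ[of U W] \<open>U \<noteq> W\<close> by blast
  qed
  then show "disjnt U W" by (simp add: disjnt_def)
qed

lemma noncrossingD:
  assumes "noncrossing P" "A \<in> P" "B \<in> P" "a \<in> A" "c \<in> A" "b \<in> B" "d \<in> B" "a < b" "b < c" "c < d"
  shows "A = B"
proof (rule ccontr)
  assume "A \<noteq> B"
  then have "\<exists>A\<in>P. \<exists>B\<in>P. A \<noteq> B \<and>
      (\<exists>a b c d. a < b \<and> b < c \<and> c < d \<and> a \<in> A \<and> c \<in> A \<and> b \<in> B \<and> d \<in> B)"
    using assms(2-) by (intro bexI[of _ A] bexI[of _ B] exI[of _ a] exI[of _ b] exI[of _ c] exI[of _ d]) auto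
  then show False using assms(1) unfolding noncrossing_def by simp
qed

text \<open>Adding the maximum \<open>m\<close> to the block \<open>V\<close> creates no crossing, because \<open>V\<close> already contains the
minimum \<open>s\<close>: in a crossing that uses \<open>m\<close> as the last of the four points, \<open>s\<close> may be put in front
instead, and the block \<open>V\<close> alone crosses the other block.\<close>

lemma noncrossing_glue_left:
  assumes P: "partition_on {s..<m} P" and Q: "partition_on {Suc m..<e} Q"
    and nP: "noncrossing P" and nQ: "noncrossing Q" and V: "V \<in> P \<and> s \<in> V \<or> V = {}"
  shows "noncrossing (insert (insert m V) (P - {V}) \<union> Q)"
  unfolding noncrossing_def
proof clarify
  fix A B a b c d
  assume A: "A \<in> insert (insert m V) (P - {V}) \<union> Q" and B: "B \<in> insert (insert m V) (P - {V}) \<union> Q"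
    and AB: "A \<noteq> B" and ord: "a < b" "b < c" "c < d" and ac: "a \<in> A" "c \<in> A" and bd: "b \<in> B" "d \<in> B"
  have PA: "s \<le> x \<and> x < m" if "U \<in> P" "x \<in> U" for U x using partition_on_memD[OF P that] by simp
  have QB: "m < x" if "U \<in> Q" "x \<in> U" for U x using partition_on_memD[OF Q that] by simp
  have VA: "x < m" if "x \<in> V" for x using V PA that by auto
  have lowA: "x \<le> m" if "x \<in> A" "A \<notin> Q" for x using that A VA PA[of A x] by fastforce
  have lowB: "x \<le> m" if "x \<in> B" "B \<notin> Q" for x using that B VA PA[of B x] by fastforce
  have "A \<notin> Q \<or> B \<notin> Q" using noncrossingD[OF nQ _ _ ac bd ord] AB by blast
  moreover have "A \<notin> Q" if "B \<notin> Q" using QB[OF _ ac(1)] lowB[OF bd(1) that] ord by force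
  moreover have "B \<notin> Q" if "A \<notin> Q" using QB[OF _ bd(1)] lowA[OF ac(2) that] ord by force
  ultimately have notQ: "A \<notin> Q" "B \<notin> Q" by blast+
  consider "A = insert m V" "B \<in> P" "B \<noteq> V" | "A \<in> P" "B = insert m V" "A \<noteq> V" | "A \<in> P" "B \<in> P"
    using A B AB notQ by blast
  then show False
  proof cases
    case 1
    then have "d < m" using PA bd by blast
    then have "a \<in> V" "c \<in> V" using 1 ac ord by auto
    then show False using noncrossingD[OF nP, of V B a c b d] 1 bd ord V by auto
  next
    case 2
    then have "c < m" using PA ac by blast
    then have b: "b \<in> V" using 2 bd ord by auto
    then have VP: "V \<in> P" "s \<in> V" using V by auto
    show False
    proof (cases "d = m")
      case True
      have "s \<noteq> a" using partition_on_disjointD[OF P 2(1) VP(1)] ac VP 2 by auto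
      then have "s < a" using PA[OF 2(1) ac(1)] by simp
      then show False using noncrossingD[OF nP, of V A s b a c] 2 b ord ac VP by auto
    next
      case False
      then have "d \<in> V" using 2 bd by auto
      then show False using noncrossingD[OF nP, of A V a c b d] 2 b ord ac VP by auto
    qed
  next
    case 3
    then show False using noncrossingD[OF nP, of A B a c b d] AB ac bd ord by auto
  qed
qed

lemma noncrossing_glue_right:
  assumes P: "partition_on {Suc m..<e} P" and Q: "partition_on {s..<m} Q"
    and nP: "noncrossing P" and nQ: "noncrossing Q" and V: "V \<in> P \<and> e - 1 \<in> V \<or> V = {}"
  shows "noncrossing (insert (insert m V) (P - {V}) \<union> Q)"
  unfolding noncrossing_def
proof clarify
  fix A B a b c d
  assume A: "A \<in> insert (insert m V) (P - {V}) \<union> Q" and B: "B \<in> insert (insert m V) (P - {V}) \<union> Q"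
    and AB: "A \<noteq> B" and ord: "a < b" "b < c" "c < d" and ac: "a \<in> A" "c \<in> A" and bd: "b \<in> B" "d \<in> B"
  have PA: "m < x \<and> x \<le> e - 1" if "U \<in> P" "x \<in> U" for U x using partition_on_memD[OF P that] by auto
  have QB: "x < m" if "U \<in> Q" "x \<in> U" for U x using partition_on_memD[OF Q that] by simp
  have VA: "m < x" if "x \<in> V" for x using V PA that by auto
  have highA: "m \<le> x" if "x \<in> A" "A \<notin> Q" for x using that A VA PA[of A x] by fastforce
  have highB: "m \<le> x" if "x \<in> B" "B \<notin> Q" for x using that B VA PA[of B x] by fastforce
  have "A \<notin> Q \<or> B \<notin> Q" using noncrossingD[OF nQ _ _ ac bd ord] AB by blast
  moreover have "A \<notin> Q" if "B \<notin> Q" using QB[OF _ ac(2)] highB[OF bd(1) that] ord by force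
  moreover have "B \<notin> Q" if "A \<notin> Q" using QB[OF _ bd(2)] highA[OF ac(2) that] ord by force
  ultimately have notQ: "A \<notin> Q" "B \<notin> Q" by blast+
  consider "A = insert m V" "B \<in> P" "B \<noteq> V" | "A \<in> P" "B = insert m V" "A \<noteq> V" | "A \<in> P" "B \<in> P"
    using A B AB notQ by blast
  then show False
  proof cases
    case 1
    then have "m < b" using PA bd by blast
    then have c: "c \<in> V" using 1 ac ord by auto
    then have VP: "V \<in> P" "e - 1 \<in> V" using V by auto
    show False
    proof (cases "a = m")
      case True
      have "e - 1 \<noteq> d" using partition_on_disjointD[OF P 1(2) VP(1)] bd VP 1 by auto
      then have "d < e - 1" using PA[OF 1(2) bd(2)] by simp
      then show False using noncrossingD[OF nP, of B V b d c "e - 1"] 1 c ord bd VP by auto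
    next
      case False
      then have "a \<in> V" using 1 ac by auto
      then show False using noncrossingD[OF nP, of V B a c b d] 1 c ord bd VP by auto
    qed
  next
    case 2
    then have "m < a" using PA ac by blast
    then have "b \<in> V" "d \<in> V" using 2 bd ord by auto
    then show False using noncrossingD[OF nP, of A V a c b d] 2 ac ord V by auto
  next
    case 3
    then show False using noncrossingD[OF nP, of A B a c b d] AB ac bd ord by auto
  qed
qed

lemma left_spine_facts:
  "left_spine t s \<subseteq> {s..<s + size t}"
  "t \<noteq> Leaf \<Longrightarrow> s \<in> left_spine t s"
  "t \<noteq> Leaf \<Longrightarrow> left_spine t s \<in> left_blocks t s"
proof -
  show "left_spine t s \<subseteq> {s..<s + size t}" by (induction t) auto
  show "t \<noteq> Leaf \<Longrightarrow> s \<in> left_spine t s"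
  proof (induction t)
    case (Node l r)
    then show ?case by (cases l) auto
  qed simp
  show "t \<noteq> Leaf \<Longrightarrow> left_spine t s \<in> left_blocks t s" by (cases t) auto
qed

lemma right_spine_facts:
  "right_spine t s \<subseteq> {s..<s + size t}"
  "t \<noteq> Leaf \<Longrightarrow> s + size t - 1 \<in> right_spine t s"
  "t \<noteq> Leaf \<Longrightarrow> right_spine t s \<in> right_blocks t s"
proof -
  show "right_spine t s \<subseteq> {s..<s + size t}"
  proof (induction t arbitrary: s)
    case (Node l r)
    show ?case using Node(2)[of "Suc (s + size l)"] by auto
  qed simp
  show "t \<noteq> Leaf \<Longrightarrow> s + size t - 1 \<in> right_spine t s"
  proof (induction t arbitrary: s)
    case (Node l r)
    show ?case using Node(2)[of "Suc (s + size l)"] by (cases "r = Leaf") (auto simp: add_ac)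
  qed simp
  show "t \<noteq> Leaf \<Longrightarrow> right_spine t s \<in> right_blocks t s" by (cases t) auto
qed

lemma interval_split_root:
  "insert (s + size l) ({s..<s + size l} \<union> {Suc (s + size l)..<Suc (s + size l) + size r}) =
     {s..<s + size (Node l r)}"
  by auto

lemma left_blocks_noncrossing:
  "partition_on {s..<s + size t} (left_blocks t s) \<and> noncrossing (left_blocks t s)"
proof (induction t arbitrary: s)
  case Leaf
  then show ?case by (simp add: partition_on_empty noncrossing_def)
next
  case (Node l r)
  have V: "left_spine l s \<in> left_blocks l s \<and> s \<in> left_spine l s \<or> left_spine l s = {}"
    using left_spine_facts by (cases "l = Leaf") auto
  show ?case
    unfolding interval_split_root[symmetric] left_blocks.simps
    by (intro conjI partition_on_glue noncrossing_glue_left[where s=s]) (use Node V in \<open>blast | simp\<close>)+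
qed

lemma right_blocks_noncrossing:
  "partition_on {s..<s + size t} (right_blocks t s) \<and> noncrossing (right_blocks t s)"
proof (induction t arbitrary: s)
  case Leaf
  then show ?case by (simp add: partition_on_empty noncrossing_def)
next
  case (Node l r)
  let ?m = "s + size l"
  have V: "right_spine r (Suc ?m) \<in> right_blocks r (Suc ?m) \<and>
      Suc ?m + size r - 1 \<in> right_spine r (Suc ?m) \<or> right_spine r (Suc ?m) = {}"
    using right_spine_facts(2,3)[of r "Suc ?m"] by (cases "r = Leaf") simp_all
  have "partition_on (insert ?m ({Suc ?m..<Suc ?m + size r} \<union> {s..<?m})) (right_blocks (Node l r) s)"
    unfolding right_blocks.simps by (intro partition_on_glue) (use Node V in \<open>blast | simp\<close>)+
  moreover have "noncrossing (right_blocks (Node l r) s)"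
    unfolding right_blocks.simps
    by (intro noncrossing_glue_right) (use Node V in \<open>blast | simp\<close>)+
  ultimately show ?case
    unfolding interval_split_root[symmetric] by (simp add: Un_commute)
qed

section \<open>The Kreweras complement of the left chains\<close>

text \<open>Together with the next two lemmas this replaces the definition by minima: the value is the next
larger element of the block, or the minimum of the block if there is none.\<close>

lemma next_in_block_eq:
  assumes "finite B" "y \<in> B" "x < y" "\<And>z. z \<in> B \<Longrightarrow> x < z \<Longrightarrow> y \<le> z"
  shows "next_in_block B x = y"
proof -
  have "Min {j \<in> B. x < j} = y" using assms by (intro Min_eqI) auto
  then show ?thesis using assms by (auto simp: next_in_block_def)
qed

lemma next_in_block_last:
  assumes "\<And>z. z \<in> B \<Longrightarrow> z \<le> x"
  shows "next_in_block B x = Min B"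
  using assms by (force simp: next_in_block_def)

lemma next_in_block_cases:
  assumes "finite B" "x \<in> B"
  obtains (succ) "next_in_block B x \<in> B" "x < next_in_block B x"
      "\<And>z. z \<in> B \<Longrightarrow> x < z \<Longrightarrow> next_in_block B x \<le> z"
    | (last) "next_in_block B x = Min B" "\<And>z. z \<in> B \<Longrightarrow> z \<le> x"
proof (cases "\<exists>j\<in>B. x < j")
  case True
  have fin: "finite {j \<in> B. x < j}" using assms by simp
  have ne: "{j \<in> B. x < j} \<noteq> {}" using True by auto
  have eq: "next_in_block B x = Min {j \<in> B. x < j}" using True by (simp add: next_in_block_def)
  show ?thesis
    by (rule succ) (use Min_in[OF fin ne] Min_le[OF fin] eq in auto)
next
  case False
  then show ?thesis by (intro last) (force simp: next_in_block_def)+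
qed

lemma next_in_block_mem:
  assumes "finite B" "x \<in> B"
  shows "next_in_block B x \<in> B"
  using next_in_block_cases[OF assms] Min_in[of B] assms by (metis empty_iff)

lemma perm_of_eq_next:
  assumes "partition_on A P" "B \<in> P" "x \<in> B"
  shows "perm_of P x = next_in_block B x"
proof -
  have "(THE C. C \<in> P \<and> x \<in> C) = B"
    using assms partition_on_disjointD[OF assms(1)] by (intro the_equality) blast+
  then show ?thesis using assms by (auto simp: perm_of_def)
qed

lemma perm_of_mem:
  assumes "partition_on A P" "finite A" "B \<in> P" "x \<in> B"
  shows "perm_of P x \<in> B"
proof -
  have "finite B" using assms by (metis Union_upper finite_subset partition_onD1)
  then show ?thesis using perm_of_eq_next[OF assms(1,3,4)] next_in_block_mem assms(4) by simp
qed

lemma partition_on_obtain: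
  assumes "partition_on A P" "x \<in> A"
  obtains B where "B \<in> P" "x \<in> B"
  using assms by (auto simp: partition_on_def)

lemma perm_of_mem_carrier:
  assumes "partition_on A P" "finite A" "x \<in> A"
  shows "perm_of P x \<in> A"
  using assms by (metis UnionI partition_onD1 partition_on_obtain perm_of_mem)

text \<open>Extending the chain of \<open>l\<close> by the root inserts \<open>m\<close> into its cycle just before \<open>s\<close>, the minimum,
and leaves the other cycles unchanged.\<close>

lemma perm_of_left_blocks_Node:
  fixes l r :: bintree and s :: nat
  defines "m \<equiv> s + size l"
  shows "y \<in> {s..<m} \<Longrightarrow> perm_of (left_blocks (Node l r) s) y =
      (if perm_of (left_blocks l s) y = s then m else perm_of (left_blocks l s) y)"
    and "perm_of (left_blocks (Node l r) s) m = s"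
    and "y \<in> {Suc m..<Suc m + size r} \<Longrightarrow>
      perm_of (left_blocks (Node l r) s) y = perm_of (left_blocks r (Suc m)) y"
proof -
  let ?P = "left_blocks l s" and ?Q = "left_blocks r (Suc m)" and ?V = "left_spine l s"
  let ?N = "left_blocks (Node l r) s"
  have N: "?N = insert (insert m ?V) (?P - {?V}) \<union> ?Q" by (simp add: m_def)
  have pP: "partition_on {s..<m} ?P" and pQ: "partition_on {Suc m..<Suc m + size r} ?Q"
    and pN: "partition_on {s..<s + size (Node l r)} ?N"
    using left_blocks_noncrossing[of s l] left_blocks_noncrossing[of "Suc m" r]
      left_blocks_noncrossing[of s "Node l r"] unfolding m_def by blast+
  have V: "?V \<subseteq> {s..<m}" using left_spine_facts(1) by (simp add: m_def)
  then have fV: "finite ?V" by (rule finite_subset) simp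
  show "perm_of ?N y = perm_of ?Q y" if y: "y \<in> {Suc m..<Suc m + size r}"
  proof -
    obtain B where B: "B \<in> ?Q" "y \<in> B" using partition_on_obtain[OF pQ y] .
    from B(1) have "B \<in> ?N" unfolding N by (rule UnI2)
    then show ?thesis using perm_of_eq_next[OF pQ B] perm_of_eq_next[OF pN _ B(2)] by simp
  qed
  have "perm_of ?N m = next_in_block (insert m ?V) m"
    by (rule perm_of_eq_next[OF pN]) (simp_all only: N Un_iff insert_iff simp_thms)
  also have "\<dots> = Min (insert m ?V)"
    using V by (intro next_in_block_last) auto
  also have "\<dots> = s"
  proof (cases "l = Leaf")
    case True
    then show ?thesis by (simp add: m_def)
  next
    case False
    then show ?thesis using V fV left_spine_facts(2)[OF False, of s]
      by (intro Min_eqI) (auto simp: m_def)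
  qed
  finally show "perm_of ?N m = s" .
  show "perm_of ?N y = (if perm_of ?P y = s then m else perm_of ?P y)" if y: "y \<in> {s..<m}"
  proof -
    obtain B where B: "B \<in> ?P" "y \<in> B" using partition_on_obtain[OF pP y] .
    have l: "l \<noteq> Leaf" using y by (auto simp: m_def)
    note sV = left_spine_facts(2,3)[OF l, of s]
    show ?thesis
    proof (cases "B = ?V")
      case False
      then have "B \<in> ?N" unfolding N using B by (intro UnI1 insertI2) simp
      then have "perm_of ?N y = perm_of ?P y"
        using perm_of_eq_next[OF pP B] perm_of_eq_next[OF pN _ B(2)] by simp
      moreover have "perm_of ?P y \<in> B" using perm_of_mem[OF pP] B by simp
      moreover have "s \<notin> B" using partition_on_disjointD[OF pP B(1) sV(2)] sV(1) False by blast
      ultimately show ?thesis by auto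
    next
      case True
      have Nn: "perm_of ?N y = next_in_block (insert m ?V) y"
        by (rule perm_of_eq_next[OF pN]) (simp_all only: N Un_iff insert_iff simp_thms B(2)[unfolded True])
      have Pn: "perm_of ?P y = next_in_block ?V y"
        using perm_of_eq_next[OF pP] B True by simp
      have MinV: "Min ?V = s" using fV sV V by (intro Min_eqI) auto
      from fV B(2)[unfolded True] show ?thesis
      proof (cases rule: next_in_block_cases)
        case succ
        have "next_in_block (insert m ?V) y = next_in_block ?V y"
          using succ fV V by (intro next_in_block_eq) auto
        then show ?thesis using succ y Nn Pn by auto
      next
        case last
        have "next_in_block (insert m ?V) y = m"
          using last(2) fV y by (intro next_in_block_eq) fastforce+
        then show ?thesis using last y Nn Pn MinV by auto
      qed
    qed
  qed
qed

text \<open>Here the root \<open>m\<close> is inserted into the cycle of the chain of \<open>r\<close> just after the maximum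
\<open>m + size r\<close>.\<close>

lemma perm_of_right_blocks_Node:
  fixes l r :: bintree and s :: nat
  defines "m \<equiv> s + size l"
  shows "y \<in> {s..<m} \<Longrightarrow> perm_of (right_blocks (Node l r) s) y = perm_of (right_blocks l s) y"
    and "perm_of (right_blocks (Node l r) s) m =
      (if r = Leaf then m else perm_of (right_blocks r (Suc m)) (m + size r))"
    and "y \<in> {Suc m..<Suc m + size r} \<Longrightarrow> perm_of (right_blocks (Node l r) s) y =
      (if y = m + size r then m else perm_of (right_blocks r (Suc m)) y)"
proof -
  let ?Q = "right_blocks l s" and ?P = "right_blocks r (Suc m)" and ?V = "right_spine r (Suc m)"
  let ?N = "right_blocks (Node l r) s"
  have N: "?N = insert (insert m ?V) (?P - {?V}) \<union> ?Q" by (simp add: m_def)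
  have pQ: "partition_on {s..<m} ?Q" and pP: "partition_on {Suc m..<Suc m + size r} ?P"
    and pN: "partition_on {s..<s + size (Node l r)} ?N"
    using right_blocks_noncrossing[of s l] right_blocks_noncrossing[of "Suc m" r]
      right_blocks_noncrossing[of s "Node l r"] unfolding m_def by blast+
  have V: "?V \<subseteq> {Suc m..<Suc m + size r}" using right_spine_facts(1) by blast
  then have fV: "finite ?V" by (rule finite_subset) simp
  have sV: "m + size r \<in> ?V" "?V \<in> ?P" if "r \<noteq> Leaf"
    using right_spine_facts(2,3)[OF that, of "Suc m"] by simp_all
  show "perm_of ?N y = perm_of ?Q y" if y: "y \<in> {s..<m}"
  proof -
    obtain B where B: "B \<in> ?Q" "y \<in> B" using partition_on_obtain[OF pQ y] .
    from B(1) have "B \<in> ?N" unfolding N by (rule UnI2)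
    then show ?thesis using perm_of_eq_next[OF pQ B] perm_of_eq_next[OF pN _ B(2)] by simp
  qed
  have Nm: "perm_of ?N m = next_in_block (insert m ?V) m"
    by (rule perm_of_eq_next[OF pN]) (simp_all only: N Un_iff insert_iff simp_thms)
  have last: "perm_of ?P (m + size r) = Min ?V" if "r \<noteq> Leaf"
  proof -
    have "perm_of ?P (m + size r) = next_in_block ?V (m + size r)"
      using sV[OF that] by (intro perm_of_eq_next[OF pP])
    also have "\<dots> = Min ?V" using V by (intro next_in_block_last) auto
    finally show ?thesis .
  qed
  show "perm_of ?N m = (if r = Leaf then m else perm_of ?P (m + size r))"
  proof (cases "r = Leaf")
    case True
    then show ?thesis using Nm next_in_block_last[of "{m}" m] by simp
  next
    case False
    then have V_ne: "?V \<noteq> {}" using sV by auto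
    have "next_in_block (insert m ?V) m = Min ?V"
      using fV V Min_in[OF fV V_ne] by (intro next_in_block_eq) auto
    then show ?thesis using Nm last False by simp
  qed
  show "perm_of ?N y = (if y = m + size r then m else perm_of ?P y)"
    if y: "y \<in> {Suc m..<Suc m + size r}"
  proof -
    obtain B where B: "B \<in> ?P" "y \<in> B" using partition_on_obtain[OF pP y] .
    have r: "r \<noteq> Leaf" using y by auto
    show ?thesis
    proof (cases "B = ?V")
      case False
      then have "B \<in> ?N" unfolding N using B by (intro UnI1 insertI2) simp
      moreover have "y \<noteq> m + size r"
        using partition_on_disjointD[OF pP B(1) sV(2)[OF r] B(2)] sV(1)[OF r] False by auto
      ultimately show ?thesis
        using perm_of_eq_next[OF pP B] perm_of_eq_next[OF pN _ B(2)] by simp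
    next
      case True
      have Nn: "perm_of ?N y = next_in_block (insert m ?V) y"
        by (rule perm_of_eq_next[OF pN]) (simp_all only: N Un_iff insert_iff simp_thms B(2)[unfolded True])
      have Pn: "perm_of ?P y = next_in_block ?V y"
        using perm_of_eq_next[OF pP] B True by simp
      from fV B(2)[unfolded True] show ?thesis
      proof (cases rule: next_in_block_cases)
        case succ
        have "next_in_block (insert m ?V) y = next_in_block ?V y"
          using succ fV y by (intro next_in_block_eq) auto
        moreover have "y \<noteq> m + size r" using succ V by auto
        ultimately show ?thesis using Nn Pn by auto
      next
        case last
        have "y = m + size r" using last(2)[OF sV(1)[OF r]] y by simp
        moreover have "next_in_block (insert m ?V) y = Min (insert m ?V)"
          using last y by (intro next_in_block_last) auto
        moreover have "Min (insert m ?V) = m" using V fV by (intro Min_eqI) auto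
        ultimately show ?thesis using Nn by simp
      qed
    qed
  qed
qed

text \<open>The right chains send a node to its right child, which the left chains send to the leftmost node
below it. Without a right child, they send it to the top of its chain, and the left chains move on
to the parent of that top. In both cases the result is the successor in symmetric order, with the
last label followed by the first.\<close>

lemma perm_of_left_right_blocks:
  assumes "x \<in> {s..<s + size t}"
  shows "perm_of (left_blocks t s) (perm_of (right_blocks t s) x) =
    (if Suc x = s + size t then s else Suc x)"
  using assms
proof (induction t arbitrary: s x)
  case Leaf
  then show ?case by simp
next
  case (Node l r)
  let ?m = "s + size l"
  let ?R = "perm_of (right_blocks (Node l r) s) x"
  note L = perm_of_left_blocks_Node[where l=l and r=r and s=s]
  note R = perm_of_right_blocks_Node[where l=l and r=r and s=s]
  have memL: "perm_of (right_blocks l s) y \<in> {s..<?m}" if "y \<in> {s..<?m}" for y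
    using perm_of_mem_carrier right_blocks_noncrossing that by blast
  have memR: "perm_of (right_blocks r (Suc ?m)) y \<in> {Suc ?m..<Suc ?m + size r}"
    if "y \<in> {Suc ?m..<Suc ?m + size r}" for y
    using perm_of_mem_carrier right_blocks_noncrossing that by blast
  consider "x \<in> {s..<?m}" | "x = ?m" "r = Leaf" | "x = ?m" "r \<noteq> Leaf" 
    | "x = ?m + size r" "x \<in> {Suc ?m..<Suc ?m + size r}"
    | "x \<noteq> ?m + size r" "x \<in> {Suc ?m..<Suc ?m + size r}"
    using Node.prems by fastforce
  then show ?case
  proof cases
    case 1
    then have "?R = perm_of (right_blocks l s) x" by (rule R)
    then show ?thesis using L(1)[OF memL[OF 1]] Node.IH(1)[OF 1] 1 by auto
  next
    case 2
    then show ?thesis using R(2) L(2) by simp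
  next
    case 3
    then have "size r > 0" by (cases r) auto
    then have last: "?m + size r \<in> {Suc ?m..<Suc ?m + size r}" by simp
    have "?R = perm_of (right_blocks r (Suc ?m)) (?m + size r)" using R(2) 3 by simp
    then show ?thesis
      using L(3)[OF memR[OF last]] Node.IH(2)[OF last] 3 \<open>size r > 0\<close> by simp
  next
    case 4
    then show ?thesis using R(3)[OF 4(2)] L(2) by simp
  next
    case 5
    then show ?thesis
      using R(3)[OF 5(2)] L(3)[OF memR[OF 5(2)]] Node.IH(2)[OF 5(2)] by simp
  qed
qed

lemma perm_of_outside: "partition_on A P \<Longrightarrow> x \<notin> A \<Longrightarrow> perm_of P x = x"
  by (auto simp: perm_of_def dest: partition_on_memD)

lemma perm_of_eq_imp_block_subset:
  assumes P: "partition_on A P" and Q: "partition_on A Q" and A: "finite A"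
    and eq: "perm_of P = perm_of Q"
    and B: "B \<in> P" and C: "C \<in> Q" and x: "Min B \<in> C" and y: "y \<in> B"
  shows "y \<in> C"
  using y
proof (induction y rule: less_induct)
  case (less y)
  have fB: "finite B" using P B A by (metis Union_upper finite_subset partition_onD1)
  show ?case
  proof (cases "\<exists>j\<in>B. j < y")
    case False
    then have "Min B = y" using fB less(2) by (intro Min_eqI) (auto simp: not_less)
    then show ?thesis using x by simp
  next
    case True
    define j where "j = Max {j \<in> B. j < y}"
    have "j \<in> {j \<in> B. j < y}" unfolding j_def using True fB by (intro Max_in) auto
    then have j: "j \<in> B" "j < y" by auto
    have j_max: "z \<le> j" if "z \<in> B" "z < y" for z
      unfolding j_def using that fB by (intro Max_ge) auto
    have "perm_of P j = y"
      unfolding perm_of_eq_next[OF P B j(1)] using fB less(2) j j_max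
      by (intro next_in_block_eq) (auto simp: not_less[symmetric])
    then show ?thesis using perm_of_mem[OF Q A C, of j] less(1)[OF j(2,1)] eq by simp
  qed
qed

text \<open>A permutation determines its cycles. Each block is reached from its minimum by repeatedly passing to
the next element, so it lies in a single block of the other partition.\<close>

lemma perm_of_inj:
  assumes P: "partition_on A P" and Q: "partition_on A Q" and A: "finite A"
    and eq: "perm_of P = perm_of Q"
  shows "P = Q"
proof -
  have sub: "B \<in> Q" if P: "partition_on A P" and Q: "partition_on A Q"
    and eq: "perm_of P = perm_of Q" and B: "B \<in> P" for P Q B
  proof -
    have ne: "U \<noteq> {}" "finite U" "U \<subseteq> A" if "U \<in> P \<or> U \<in> Q" for U
      using that P Q A by (auto simp: partition_on_def intro: finite_subset)
    have mB: "Min B \<in> B" using ne B by (intro Min_in) auto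
    then have "Min B \<in> A" by (rule partition_on_memD[OF P B])
    then obtain C where C: "C \<in> Q" "Min B \<in> C" by (rule partition_on_obtain[OF Q])
    have BC: "B \<subseteq> C" using perm_of_eq_imp_block_subset[OF P Q A eq B C] by blast
    have mC: "Min C \<in> C" using ne C by (intro Min_in) auto
    then have "Min C \<in> A" by (rule partition_on_memD[OF Q C(1)])
    then obtain D where D: "D \<in> P" "Min C \<in> D" by (rule partition_on_obtain[OF P])
    have CD: "C \<subseteq> D" using perm_of_eq_imp_block_subset[OF Q P A eq[symmetric] C(1) D] by blast
    have "Min B \<in> D" using mB BC CD by blast
    then have "B = D" by (rule partition_on_disjointD[OF P B D(1) mB])
    then have "B = C" using BC CD by (intro equalityI) simp_all
    then show ?thesis using C by simp
  qed
  show ?thesis using sub[OF P Q eq] sub[OF Q P eq[symmetric]] by blast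
qed

text \<open>The product of the two permutations is the long cycle $P_{1_n}$. In particular the permutation of the
left chains is onto, hence injective by finiteness, and may be cancelled.\<close>

theorem Kreweras_left_blocks:
  assumes "size t > 0"
  shows "Kreweras (size t) (left_blocks t 1) = right_blocks t 1"
proof -
  let ?n = "size t" and ?P = "left_blocks t 1" and ?K = "right_blocks t 1"
  have I: "{1..<1 + ?n} = {1..?n}" by auto
  have P: "partition_on {1..?n} ?P" and K: "partition_on {1..?n} ?K" "noncrossing ?K"
    using left_blocks_noncrossing[of 1 t] right_blocks_noncrossing[of 1 t] unfolding I by auto
  have one: "partition_on {1..?n} {{1..?n}}" using assms by (intro partition_on_space) auto
  define c where "c = perm_of {{1..?n}}"
  have c: "c x = (if x = ?n then 1 else Suc x)" if "x \<in> {1..?n}" for x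
  proof -
    have "c x = next_in_block {1..?n} x"
      unfolding c_def using that by (intro perm_of_eq_next[OF one]) auto
    also have "\<dots> = (if x = ?n then 1 else Suc x)"
    proof (cases "x = ?n")
      case True
      have "next_in_block {1..?n} x = Min {1..?n}" using True by (intro next_in_block_last) auto
      also have "\<dots> = 1" using assms by (intro Min_eqI) auto
      finally show ?thesis using True by simp
    next
      case False
      then have "next_in_block {1..?n} x = Suc x" using that by (intro next_in_block_eq) auto
      then show ?thesis using False by simp
    qed
    finally show ?thesis .
  qed
  have comp: "perm_of ?P \<circ> perm_of ?K = c"
  proof
    fix x
    show "(perm_of ?P \<circ> perm_of ?K) x = c x"
    proof (cases "x \<in> {1..?n}")
      case True
      then show ?thesis using perm_of_left_right_blocks[of x 1 t] c[OF True] by auto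
    next
      case False
      then show ?thesis
        using perm_of_outside[OF P False] perm_of_outside[OF K(1) False]
          perm_of_outside[OF one False] by (simp add: c_def)
    qed
  qed
  have "{1..?n} \<subseteq> perm_of ?P ` {1..?n}"
  proof
    fix y assume y: "y \<in> {1..?n}"
    define x where "x = (if y = 1 then ?n else y - 1)"
    have x: "x \<in> {1..?n}" using y assms by (auto simp: x_def)
    have "c x = y" unfolding c[OF x] using y by (auto simp: x_def)
    then have "y = perm_of ?P (perm_of ?K x)" using comp by (metis comp_apply)
    then show "y \<in> perm_of ?P ` {1..?n}" using perm_of_mem_carrier[OF K(1) _ x] by blast
  qed
  then have inj: "inj_on (perm_of ?P) {1..?n}" by (intro finite_surj_inj) auto
  have "inj (perm_of ?P)"
  proof (rule injI)
    fix x y assume xy: "perm_of ?P x = perm_of ?P y"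
    have mem: "perm_of ?P z \<in> {1..?n} \<longleftrightarrow> z \<in> {1..?n}" for z
      using perm_of_mem_carrier[OF P] perm_of_outside[OF P, of z] by (cases "z \<in> {1..?n}") auto
    show "x = y"
    proof (cases "x \<in> {1..?n}")
      case True
      then show ?thesis using inj_onD[OF inj xy] mem[of x] mem[of y] xy by simp
    next
      case False
      then have "y \<notin> {1..?n}" using mem[of x] mem[of y] xy by simp
      then show ?thesis using perm_of_outside[OF P False] perm_of_outside[OF P, of y] xy by simp
    qed
  qed
  then have K_eq: "perm_of ?K = inv (perm_of ?P) \<circ> c"
    unfolding comp[symmetric] by (simp add: comp_assoc[symmetric])
  show ?thesis
    unfolding Kreweras_def c_def[symmetric]
  proof (rule the_equality)
    show "?K \<in> NC ?n \<and> perm_of ?K = inv (perm_of ?P) \<circ> c" using K K_eq by (simp add: NC_def)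
    fix \<sigma> assume "\<sigma> \<in> NC ?n \<and> perm_of \<sigma> = inv (perm_of ?P) \<circ> c"
    then show "\<sigma> = ?K" using perm_of_inj[OF _ K(1)] K_eq by (simp add: NC_def)
  qed
qed

section \<open>Every non-crossing partition comes from one tree\<close>

text \<open>The trace of a partition on a subset; it recovers the chains of the two subtrees from those of the
whole tree.\<close>

definition restrict_blocks :: "'a set \<Rightarrow> 'a set set \<Rightarrow> 'a set set" where
  "restrict_blocks A P = (\<inter>) A ` P - {{}}"

lemma restrict_blocks_glue:
  assumes P: "partition_on A P" and Q: "partition_on B Q" and AB: "A \<inter> B = {}"
    and m: "m \<notin> A" "m \<notin> B" and V: "V \<in> P \<or> V = {}"
  shows "restrict_blocks A (insert (insert m V) (P - {V}) \<union> Q) = P"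
    and "restrict_blocks B (insert (insert m V) (P - {V}) \<union> Q) = Q"
proof -
  have PA: "A \<inter> U = U" "B \<inter> U = {}" if "U \<in> P" for U using that P AB by (auto simp: partition_on_def)
  have QB: "A \<inter> U = {}" "B \<inter> U = U" if "U \<in> Q" for U using that Q AB by (auto simp: partition_on_def)
  have V': "A \<inter> insert m V = V" "B \<inter> insert m V = {}" using V PA m by auto
  have imP: "(\<inter>) A ` (P - {V}) = P - {V}" "(\<inter>) B ` (P - {V}) \<subseteq> {{}}"
    using PA by (auto simp: image_def)
  have imQ: "(\<inter>) A ` Q \<subseteq> {{}}" "(\<inter>) B ` Q = Q"
    using QB by (auto simp: image_def)
  have ne: "{} \<notin> P" "{} \<notin> Q" using P Q by (auto simp: partition_on_def)
  show "restrict_blocks A (insert (insert m V) (P - {V}) \<union> Q) = P"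
    unfolding restrict_blocks_def image_Un image_insert V' imP using imQ V ne by blast
  show "restrict_blocks B (insert (insert m V) (P - {V}) \<union> Q) = Q"
    unfolding restrict_blocks_def image_Un image_insert V' imQ using imP V ne by blast
qed

lemma noncrossing_restrict_blocks:
  assumes "noncrossing P"
  shows "noncrossing (restrict_blocks A P)"
  unfolding noncrossing_def
proof clarify
  fix B C a b c d
  assume "B \<in> restrict_blocks A P" "C \<in> restrict_blocks A P" "B \<noteq> C" "a < b" "b < c" "c < d"
    "a \<in> B" "c \<in> B" "b \<in> C" "d \<in> C"
  moreover from this obtain B' C' where "B = A \<inter> B'" "C = A \<inter> C'" "B' \<in> P" "C' \<in> P"
    unfolding restrict_blocks_def by blast
  ultimately show False using noncrossingD[OF assms, of B' C' a c b d] by blast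
qed

lemma restrict_left_blocks_Node:
  fixes l r :: bintree and s :: nat
  defines "m \<equiv> s + size l"
  shows "restrict_blocks {s..<m} (left_blocks (Node l r) s) = left_blocks l s"
    and "restrict_blocks {Suc m..<Suc m + size r} (left_blocks (Node l r) s) = left_blocks r (Suc m)"
proof -
  have P: "partition_on {s..<m} (left_blocks l s)"
    and Q: "partition_on {Suc m..<Suc m + size r} (left_blocks r (Suc m))"
    using left_blocks_noncrossing[of s l] left_blocks_noncrossing[of "Suc m" r]
    unfolding m_def by blast+
  have V: "left_spine l s \<in> left_blocks l s \<or> left_spine l s = {}"
    using left_spine_facts(3) by (cases "l = Leaf") auto
  show "restrict_blocks {s..<m} (left_blocks (Node l r) s) = left_blocks l s"
    "restrict_blocks {Suc m..<Suc m + size r} (left_blocks (Node l r) s) = left_blocks r (Suc m)"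
    using restrict_blocks_glue[OF P Q _ _ _ V, of m] by (simp_all add: m_def)
qed

text \<open>The root is the maximum of the block of \<open>s\<close>, and the chains of the subtrees are the traces of the
partition on the two sides of the root.\<close>

lemma left_blocks_inj:
  assumes "left_blocks t s = left_blocks t' s"
  shows "t = t'"
  using assms
proof (induction t arbitrary: t' s)
  case Leaf
  then show ?case by (cases t') auto
next
  case (Node l r)
  obtain l' r' where t': "t' = Node l' r'" using Node.prems by (cases t') auto
  let ?P = "left_blocks (Node l r) s"
  have P: "partition_on {s..<s + size (Node l r)} ?P"
    and P': "partition_on {s..<s + size t'} ?P"
    using left_blocks_noncrossing[of s "Node l r"] left_blocks_noncrossing[of s t'] Node.prems
    by auto
  then have "{s..<s + size (Node l r)} = {s..<s + size t'}" by (metis partition_onD1)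
  then have size: "size (Node l r) = size t'"
    by (metis add_diff_cancel_left' card_atLeastLessThan)
  have spine: "left_spine (Node l r) s = left_spine (Node l' r') s"
    using partition_on_disjointD[OF P] left_spine_facts(2,3)[of "Node l r" s]
      left_spine_facts(2,3)[of t' s] Node.prems t' by (metis bintree.distinct(1))
  have Max: "Max (left_spine (Node l r) s) = s + size l" for l r :: bintree
  proof (rule Max_eqI)
    show "finite (left_spine (Node l r) s)"
      by (rule finite_subset[OF left_spine_facts(1)]) simp
  qed (use left_spine_facts(1)[of l s] in auto)
  have l: "size l = size l'" using Max[of l r] Max[of l' r'] spine by simp
  then have r: "size r = size r'" using size t' by simp
  have "left_blocks l s = left_blocks l' s"
    using restrict_left_blocks_Node(1)[of s l r] restrict_left_blocks_Node(1)[of s l' r']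
    unfolding t'[symmetric] Node.prems l by simp
  moreover have "left_blocks r (Suc (s + size l)) = left_blocks r' (Suc (s + size l))"
    using restrict_left_blocks_Node(2)[of s l r] restrict_left_blocks_Node(2)[of s l' r']
    unfolding t'[symmetric] Node.prems l r by simp
  ultimately show ?case using Node.IH t' by blast
qed

text \<open>Let \<open>m\<close> be the maximum of the block \<open>W\<close> of \<open>s\<close>. A block other than \<open>W\<close> with elements on both sides of
\<open>m\<close> would cross \<open>W\<close> at \<open>s\<close> and \<open>m\<close>. So the partition is glued together at \<open>m\<close> from its traces on the two
sides, which belong to trees by induction.\<close>

lemma left_blocks_surj:
  assumes "partition_on {s..<s + n} \<pi>" "noncrossing \<pi>"
  shows "\<exists>t. size t = n \<and> left_blocks t s = \<pi>"
  using assms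
proof (induction n arbitrary: s \<pi> rule: less_induct)
  case (less n)
  note P = less.prems(1) and nc = less.prems(2)
  show ?case
  proof (cases "n = 0")
    case True
    then show ?thesis using P by (intro exI[of _ Leaf]) (simp add: partition_on_empty)
  next
    case False
    then have "s \<in> {s..<s + n}" by simp
    then obtain W where W: "W \<in> \<pi>" "s \<in> W" using partition_on_obtain[OF P] by blast
    have sub: "B \<subseteq> {s..<s + n}" if "B \<in> \<pi>" for B using P that by (auto simp: partition_on_def)
    have fW: "finite W" using sub[OF W(1)] by (rule finite_subset) simp
    define m where "m = Max W"
    have mW: "m \<in> W" unfolding m_def using fW W by (intro Max_in) auto
    have Wm: "x \<le> m" if "x \<in> W" for x unfolding m_def using fW that by simp
    have m: "s \<le> m" "m < s + n" using sub[OF W(1)] mW by auto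
    let ?A = "{s..<m}" and ?B = "{Suc m..<s + n}"
    have split: "B \<subseteq> ?A \<or> B \<subseteq> ?B" if B: "B \<in> \<pi>" "B \<noteq> W" for B
    proof (rule ccontr)
      have BW: "x \<notin> B" if "x \<in> W" for x using partition_on_disjointD[OF P B(1) W(1)] that B by blast
      assume "\<not> (B \<subseteq> ?A \<or> B \<subseteq> ?B)"
      then obtain x y where "x \<in> B" "x \<notin> ?A" "y \<in> B" "y \<notin> ?B" by blast
      then have xy: "x \<in> B" "m < x" "y \<in> B" "y < m" "s < y"
        using sub[OF B(1)] BW[OF mW] BW[OF W(2)]
        by (auto simp: subset_iff) (metis atLeastLessThan_iff linorder_neqE_nat not_less Suc_le_eq le_neq_implies_less)+
      then have "W = B" using noncrossingD[OF nc W(1) B(1), of s m y x] W mW by simp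
      then show False using B by simp
    qed
    have W_A: "insert m (?A \<inter> W) = W" using mW Wm sub[OF W(1)] by fastforce
    define P1 where "P1 = restrict_blocks ?A \<pi>"
    define P2 where "P2 = restrict_blocks ?B \<pi>"
    have IA: "?A \<inter> {s..<s + n} = ?A" and IB: "?B \<inter> {s..<s + n} = ?B" using m by auto
    have "partition_on ?A P1" "partition_on ?B P2"
      using partition_on_restrict[OF P, of ?A] partition_on_restrict[OF P, of ?B]
      unfolding P1_def P2_def restrict_blocks_def IA IB by simp_all
    moreover have "noncrossing P1" "noncrossing P2"
      using noncrossing_restrict_blocks[OF nc] by (simp_all add: P1_def P2_def)
    moreover have "?A = {s..<s + (m - s)}" "?B = {Suc m..<Suc m + (s + n - Suc m)}" using m by auto
    moreover have "m - s < n" "s + n - Suc m < n" using m by auto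
    ultimately obtain l r where l: "size l = m - s" "left_blocks l s = P1"
      and r: "size r = s + n - Suc m" "left_blocks r (Suc m) = P2"
      using less.IH by (metis (no_types, lifting))
    have sl: "s + size l = m" using l m by simp
    have spine: "left_spine l s = ?A \<inter> W"
    proof (cases "l = Leaf")
      case True
      then show ?thesis using sl by simp
    next
      case False
      then have "size l > 0" by (cases l) auto
      then have "s \<in> ?A" using sl by simp
      then have "?A \<inter> W \<in> left_blocks l s" "s \<in> ?A \<inter> W"
        using W unfolding l P1_def restrict_blocks_def by blast+
      then show ?thesis
        using partition_on_disjointD[OF conjunct1[OF left_blocks_noncrossing], of "left_spine l s" l s]
          left_spine_facts(2,3)[OF False, of s] by blast
    qed
    have ne: "{} \<notin> \<pi>" using P by (simp add: partition_on_def)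
    have dW: "B \<inter> W = {}" if "B \<in> \<pi>" "B \<noteq> W" for B
      using partition_on_disjointD[OF P that(1) W(1)] that by blast
    have P1: "P1 - {?A \<inter> W} = {B \<in> \<pi>. B \<noteq> W \<and> B \<subseteq> ?A}"
    proof (intro equalityI subsetI)
      fix B assume "B \<in> P1 - {?A \<inter> W}"
      then obtain B' where B': "B = ?A \<inter> B'" "B' \<in> \<pi>" "B \<noteq> {}" "B' \<noteq> W"
        unfolding P1_def restrict_blocks_def by blast
      then have "B' \<subseteq> ?A" using split[OF B'(2,4)] by fastforce
      then have "B = B'" using B' by blast
      then show "B \<in> {B \<in> \<pi>. B \<noteq> W \<and> B \<subseteq> ?A}" using B' \<open>B' \<subseteq> ?A\<close> by blast
    next
      fix B assume B: "B \<in> {B \<in> \<pi>. B \<noteq> W \<and> B \<subseteq> ?A}"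
      then have "B = ?A \<inter> B" "B \<noteq> {}" using ne by auto
      moreover have "B \<noteq> ?A \<inter> W" using dW[of B] B \<open>B \<noteq> {}\<close> by blast
      ultimately show "B \<in> P1 - {?A \<inter> W}" using B unfolding P1_def restrict_blocks_def by blast
    qed
    have P2: "P2 = {B \<in> \<pi>. B \<noteq> W \<and> B \<subseteq> ?B}"
    proof (intro equalityI subsetI)
      fix B assume "B \<in> P2"
      then obtain B' where B': "B = ?B \<inter> B'" "B' \<in> \<pi>" "B \<noteq> {}"
        unfolding P2_def restrict_blocks_def by blast
      have "?B \<inter> W = {}" using Wm by fastforce
      then have "B' \<noteq> W" using B' by blast
      then have "B' \<subseteq> ?B" using split[of B'] B' by fastforce
      then have "B = B'" using B' by blast
      then show "B \<in> {B \<in> \<pi>. B \<noteq> W \<and> B \<subseteq> ?B}" using B' \<open>B' \<subseteq> ?B\<close> \<open>B' \<noteq> W\<close> by blast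
    next
      fix B assume B: "B \<in> {B \<in> \<pi>. B \<noteq> W \<and> B \<subseteq> ?B}"
      then have "B = ?B \<inter> B" "B \<noteq> {}" using ne by auto
      then show "B \<in> P2" using B unfolding P2_def restrict_blocks_def by blast
    qed
    have "left_blocks (Node l r) s = insert W (P1 - {?A \<inter> W}) \<union> P2"
      by (simp only: left_blocks.simps sl spine l(2) r(2) W_A)
    also have "\<dots> = \<pi>" unfolding P1 P2 using W split by blast
    finally have "left_blocks (Node l r) s = \<pi>" .
    moreover have "size (Node l r) = n" using l r m by simp
    ultimately show ?thesis by blast
  qed
qed

theorem bij_betw_left_blocks: "bij_betw (\<lambda>t. left_blocks t 1) (trees n) (NC n)"
proof (rule bij_betw_imageI)
  show "inj_on (\<lambda>t. left_blocks t 1) (trees n)" by (rule inj_onI) (rule left_blocks_inj)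
  have I: "{1..<1 + n} = {1..n}" by auto
  show "(\<lambda>t. left_blocks t 1) ` trees n = NC n"
  proof (intro equalityI subsetI)
    fix \<pi> assume "\<pi> \<in> (\<lambda>t. left_blocks t 1) ` trees n"
    then obtain t where "\<pi> = left_blocks t 1" "size t = n" unfolding trees_def by blast
    then show "\<pi> \<in> NC n" using left_blocks_noncrossing[of 1 t] I by (simp add: NC_def)
  next
    fix \<pi> assume "\<pi> \<in> NC n"
    then obtain t where "size t = n" "left_blocks t 1 = \<pi>"
      using left_blocks_surj[of 1 n \<pi>] unfolding NC_def I by blast
    then show "\<pi> \<in> (\<lambda>t. left_blocks t 1) ` trees n" unfolding trees_def by blast
  qed
qed

lemma card_left_spine: "card (left_spine t s) = left_length t"
proof (induction t)
  case (Node l r)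
  have "s + size l \<notin> left_spine l s" "finite (left_spine l s)"
    using left_spine_facts(1)[of l s] by (auto intro: finite_subset)
  then show ?case using Node by simp
qed simp

lemma card_right_spine: "card (right_spine t s) = right_length t"
proof (induction t arbitrary: s)
  case (Node l r)
  let ?m = "Suc (s + size l)"
  have "s + size l \<notin> right_spine r ?m" "finite (right_spine r ?m)"
    using right_spine_facts(1)[of r ?m] by (auto intro: finite_subset)
  then show ?case using Node by simp
qed simp

lemma prod_blocks_glue:
  fixes f :: "'a set \<Rightarrow> 'b::comm_monoid_mult"
  assumes P: "partition_on A P" and Q: "partition_on B Q" and AB: "A \<inter> B = {}"
    and m: "m \<notin> A" "m \<notin> B" and fin: "finite A" "finite B"
  shows "prod f ((insert (insert m V) (P - {V}) \<union> Q) - {insert m V}) = prod f (P - {V}) * prod f Q"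
proof -
  have PA: "U \<subseteq> A" if "U \<in> P" for U using that P by (auto simp: partition_on_def)
  have QB: "U \<subseteq> B" "U \<noteq> {}" if "U \<in> Q" for U using that Q by (auto simp: partition_on_def)
  have fP: "finite P" "finite Q" using finite_elements[OF fin(1) P] finite_elements[OF fin(2) Q] by auto
  have "insert m V \<notin> (P - {V}) \<union> Q" using PA QB m by blast
  then have "(insert (insert m V) (P - {V}) \<union> Q) - {insert m V} = (P - {V}) \<union> Q"
    unfolding Un_insert_left by (rule Diff_insert_absorb)
  moreover have "(P - {V}) \<inter> Q = {}"
  proof (rule equals0I)
    fix U assume "U \<in> (P - {V}) \<inter> Q"
    then have "U \<subseteq> A \<inter> B" "U \<noteq> {}" using PA[of U] QB[of U] by blast+
    then show False using AB by blast
  qed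
  ultimately show ?thesis using fP by (simp add: prod.union_disjoint)
qed

text \<open>By induction only the blocks other than the chain of the root need to be compared with
\<open>inner_weight\<close>. Since \<open>f 0 = 1\<close>, an empty subtree contributes the factor $1$.\<close>

lemma prod_left_blocks:
  fixes f :: "nat \<Rightarrow> 'a::comm_monoid_mult"
  assumes f0: "f 0 = 1"
  shows "(\<Prod>B\<in>left_blocks t s. f (card B)) = f (left_length t) * inner_weight f t"
proof -
  have whole: "(\<Prod>B\<in>left_blocks t s. f (card B)) =
      f (left_length t) * (\<Prod>B\<in>left_blocks t s - {left_spine t s}. f (card B))" for t s
  proof (cases "t = Leaf")
    case False
    have "finite (left_blocks t s)"
      using finite_elements[OF _ conjunct1[OF left_blocks_noncrossing]] by blast
    then show ?thesis
      using left_spine_facts(3)[OF False, of s]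
      by (subst prod.remove[where x="left_spine t s"]) (simp_all add: card_left_spine)
  qed (simp add: f0)
  have "(\<Prod>B\<in>left_blocks t s - {left_spine t s}. f (card B)) = inner_weight f t"
  proof (induction t arbitrary: s)
    case (Node l r)
    let ?m = "s + size l"
    have "(\<Prod>B\<in>left_blocks (Node l r) s - {left_spine (Node l r) s}. f (card B)) =
        (\<Prod>B\<in>left_blocks l s - {left_spine l s}. f (card B)) *
        (\<Prod>B\<in>left_blocks r (Suc ?m). f (card B))"
      unfolding left_blocks.simps left_spine.simps
      by (rule prod_blocks_glue[where A="{s..<?m}" and B="{Suc ?m..<Suc ?m + size r}"])
        (rule conjunct1[OF left_blocks_noncrossing] | simp)+
    then show ?case by (simp add: Node whole[of r])
  qed simp
  then show ?thesis using whole by simp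
qed

lemma prod_right_blocks:
  fixes g :: "nat \<Rightarrow> 'a::comm_monoid_mult"
  assumes g0: "g 0 = 1"
  shows "(\<Prod>B\<in>right_blocks t s. g (card B)) = g (right_length t) * inner_weight g (mirror t)"
proof -
  have whole: "(\<Prod>B\<in>right_blocks t s. g (card B)) =
      g (right_length t) * (\<Prod>B\<in>right_blocks t s - {right_spine t s}. g (card B))" for t s
  proof (cases "t = Leaf")
    case False
    have "finite (right_blocks t s)"
      using finite_elements[OF _ conjunct1[OF right_blocks_noncrossing]] by blast
    then show ?thesis
      using right_spine_facts(3)[OF False, of s]
      by (subst prod.remove[where x="right_spine t s"]) (simp_all add: card_right_spine)
  qed (simp add: g0)
  have "(\<Prod>B\<in>right_blocks t s - {right_spine t s}. g (card B)) = inner_weight g (mirror t)"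
  proof (induction t arbitrary: s)
    case (Node l r)
    let ?m = "s + size l"
    have "(\<Prod>B\<in>right_blocks (Node l r) s - {right_spine (Node l r) s}. g (card B)) =
        (\<Prod>B\<in>right_blocks r (Suc ?m) - {right_spine r (Suc ?m)}. g (card B)) *
        (\<Prod>B\<in>right_blocks l s. g (card B))"
      unfolding right_blocks.simps right_spine.simps
      by (rule prod_blocks_glue[where B="{s..<?m}" and A="{Suc ?m..<Suc ?m + size r}"])
        (rule conjunct1[OF right_blocks_noncrossing] | simp)+
    then show ?case by (simp add: Node whole[of l])
  qed simp
  then show ?thesis using whole by simp
qed

theorem sum_NC_eq_tree_series:
  fixes f g :: "nat \<Rightarrow> 'a::comm_ring_1"
  assumes "f 0 = 1" "g 0 = 1" "n > 0"
  shows "(\<Sum>\<pi>\<in>NC n. (\<Prod>B\<in>\<pi>. f (card B)) * (\<Prod>B\<in>Kreweras n \<pi>. g (card B))) =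
    tree_series (chain_weight f f g g) $ n"
proof -
  have "(\<Sum>\<pi>\<in>NC n. (\<Prod>B\<in>\<pi>. f (card B)) * (\<Prod>B\<in>Kreweras n \<pi>. g (card B))) =
      (\<Sum>t\<in>trees n. (\<Prod>B\<in>left_blocks t 1. f (card B)) *
        (\<Prod>B\<in>Kreweras n (left_blocks t 1). g (card B)))"
    by (rule sum.reindex_bij_betw[OF bij_betw_left_blocks, symmetric])
  also have "\<dots> = (\<Sum>t\<in>trees n. chain_weight f f g g t)"
  proof (rule sum.cong[OF refl])
    fix t assume "t \<in> trees n"
    then have "n = size t" by (simp add: trees_def)
    then show "(\<Prod>B\<in>left_blocks t 1. f (card B)) * (\<Prod>B\<in>Kreweras n (left_blocks t 1). g (card B)) =
        chain_weight f f g g t"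
      using Kreweras_left_blocks[of t] assms
      by (simp add: prod_left_blocks prod_right_blocks chain_weight_def)
  qed
  finally show ?thesis by simp
qed

lemma Kreweras_NC:
  assumes "\<pi> \<in> NC n" "n > 0"
  shows "Kreweras n \<pi> \<in> NC n"
proof -
  obtain t where t: "size t = n" "\<pi> = left_blocks t 1"
    using assms(1) bij_betw_left_blocks[of n] by (auto simp: bij_betw_def trees_def)
  have "{1..<1 + size t} = {1..n}" using t by auto
  then show ?thesis
    using right_blocks_noncrossing[of 1 t] Kreweras_left_blocks[of t] t assms(2)
    by (simp add: NC_def)
qed

lemma NC_block_card_pos:
  assumes "\<pi> \<in> NC n" "B \<in> \<pi>"
  shows "card B > 0"
proof -
  have P: "partition_on {1..n} \<pi>" using assms by (simp add: NC_def)
  have "B \<subseteq> {1..n}" using partition_on_memD[OF P assms(2)] by blast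
  then have "finite B" by (rule finite_subset) simp
  moreover have "B \<noteq> {}" using P assms(2) by (auto simp: partition_on_def)
  ultimately show ?thesis by (simp add: card_gt_0_iff)
qed

section \<open>Characters and their convolution\<close>

definition character :: "(nat \<Rightarrow> complex) \<Rightarrow> Yalg \<Rightarrow> complex" where
  "character = Yextend id"

lemma character_hom [simp]:
  "character v 0 = 0"
  "character v 1 = 1"
  "character v (Poly_Mapping.single 0 c) = c"
  "character v (p + q) = character v p + character v q"
  "character v (p * q) = character v p * character v q"
  by (simp_all only: character_def Yextend_hom id_apply) (simp add: Yextend_def)

lemma character_Ygen: "n \<ge> 2 \<Longrightarrow> character v (Ygen n) = v n"
  unfolding character_def by (rule Yextend_hom) simp_all

lemma character_prod: "character a (\<Prod>x\<in>A. p x) = (\<Prod>x\<in>A. character a (p x))"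
  by (induction A rule: infinite_finite_induct) simp_all

lemma character_Ypart:
  assumes "a 1 = 1" "\<pi> \<in> NC n"
  shows "character a (Ypart \<pi>) = (\<Prod>B\<in>\<pi>. a (card B))"
  unfolding Ypart_def character_prod
proof (rule prod.cong[OF refl])
  fix B assume "B \<in> \<pi>"
  then have "card B > 0" by (rule NC_block_card_pos[OF assms(2)])
  then consider "card B = 1" | "card B \<ge> 2" by linarith
  then show "character a (Ygen (card B)) = a (card B)"
  proof cases
    case 1
    then show ?thesis using assms(1) by (simp add: Ygen_def)
  qed (rule character_Ygen)
qed

lemma tensor_functional_sum:
  "tensor_functional \<xi> \<eta> (\<Sum>x\<in>A. t x) = (\<Sum>x\<in>A. tensor_functional \<xi> \<eta> (t x))"
  by (induction A rule: infinite_finite_induct)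
    (simp_all add: tensor_functional_add, simp_all add: tensor_functional_def)

lemma tensor_functional_single:
  "tensor_functional \<xi> \<eta> (Poly_Mapping.single (m, m') c) =
     c * (\<xi> (Poly_Mapping.single m 1) * \<eta> (Poly_Mapping.single m' 1))"
  by (subst tensor_functional_superset[where S="{(m, m')}"]) (auto simp: lookup_single)

text \<open>A tensor product of characters is a character of the tensor square. With it, convolutions of
characters are determined by their values on the generators.\<close>

lemma tensor_functional_mult:
  "tensor_functional (character a) (character b) (s * t) =
     tensor_functional (character a) (character b) s * tensor_functional (character a) (character b) t"
proof (induction s rule: poly_mapping_induct)
  case s: (single k c)
  show ?case
  proof (induction t rule: poly_mapping_induct)
    case t: (single l d)
    obtain m m' n n' where [simp]: "k = (m, m')" "l = (n, n')" by fastforce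
    have "character a (Poly_Mapping.single (m + n) 1) =
        character a (Poly_Mapping.single m 1) * character a (Poly_Mapping.single n 1)" for a m n
      by (simp add: mult_single flip: character_hom(5))
    then show ?case by (simp add: mult_single tensor_functional_single mult_ac)
  qed (simp add: distrib_left tensor_functional_add)
qed (simp add: distrib_right tensor_functional_add)

theorem convolution_character:
  assumes a: "a 1 = 1" and b: "b 1 = 1"
    and c: "\<And>n. n \<ge> 2 \<Longrightarrow>
      c n = (\<Sum>\<pi>\<in>NC n. (\<Prod>B\<in>\<pi>. a (card B)) * (\<Prod>B\<in>Kreweras n \<pi>. b (card B)))"
  shows "convolution (character a) (character b) = character c"
proof -
  have "convolution (character a) (character b) = Yextend id c"
  proof (rule Yextend_unique)
    let ?D = "\<lambda>n. \<Sum>\<pi>\<in>NC n. tensor (Ypart \<pi>) (Ypart (Kreweras n \<pi>))"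
    note hom = Yextend_hom[where \<iota>="Poly_Mapping.single 0 :: complex \<Rightarrow> Yalg2" and v="?D",
        folded comult_def, simplified single_zero single_one single_add mult_single]
    show "convolution (character a) (character b) (p + q) =
        convolution (character a) (character b) p + convolution (character a) (character b) q" for p q
      by (simp add: convolution_def hom tensor_functional_add)
    show "convolution (character a) (character b) (p * q) =
        convolution (character a) (character b) p * convolution (character a) (character b) q" for p q
      by (simp add: convolution_def hom tensor_functional_mult)
    show "convolution (character a) (character b) (Poly_Mapping.single 0 x) = id x" for x
      by (simp add: convolution_def hom tensor_functional_single zero_prod_def)
    fix n :: nat assume n: "n \<ge> 2"
    have "convolution (character a) (character b) (Ygen n) =
        (\<Sum>\<pi>\<in>NC n. character a (Ypart \<pi>) * character b (Ypart (Kreweras n \<pi>)))"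
      using n by (simp add: convolution_def hom tensor_functional_sum tensor_functional_tensor)
    also have "\<dots> = c n"
      unfolding c[OF n]
    proof (rule sum.cong[OF refl])
      fix \<pi> assume \<pi>: "\<pi> \<in> NC n"
      show "character a (Ypart \<pi>) * character b (Ypart (Kreweras n \<pi>)) =
          (\<Prod>B\<in>\<pi>. a (card B)) * (\<Prod>B\<in>Kreweras n \<pi>. b (card B))"
        using a b \<pi> Kreweras_NC[OF \<pi>] n by (simp add: character_Ypart)
    qed
    finally show "convolution (character a) (character b) (Ygen n) = c n" .
  qed simp_all
  then show ?thesis by (simp add: character_def)
qed

section \<open>Characters indexed by their $S$-series\<close>

text \<open>The coefficients of $(z S)^{\langle-1\rangle}$. For the $S$-transform of a distribution this
series is the $R$-transform.\<close>

definition S_inverse :: "'a::field fps \<Rightarrow> nat \<Rightarrow> 'a" where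
  "S_inverse S n = fps_inv (fps_X * S) $ n"

lemma S_inverse_0 [simp]: "S_inverse S 0 = 0"
  by (simp add: S_inverse_def fps_inv_def)

lemma S_inverse_1: "S $ 0 = 1 \<Longrightarrow> S_inverse S 1 = 1"
  by (simp add: S_inverse_def fps_inv_def)

text \<open>The tree series have constant term $1$, which makes the weight of an empty chain equal to $1$; the
coefficient of $z^0$ of $(z S)^{\langle-1\rangle}$ is $0$, so it is replaced by $1$ here. Blocks are never
empty, hence the sums agree.\<close>

theorem NC_sum_S_inverse:
  fixes S T :: "'a::field fps"
  assumes S: "S $ 0 = 1" and T: "T $ 0 = 1" and n: "n > 0"
  shows "(\<Sum>\<pi>\<in>NC n. (\<Prod>B\<in>\<pi>. S_inverse S (card B)) * (\<Prod>B\<in>Kreweras n \<pi>. S_inverse T (card B))) =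
    S_inverse (S * T) n"
proof -
  let ?f = "\<lambda>U n. if n = 0 then 1 else S_inverse U n :: 'a"
  have f: "Abs_fps (?f U) = 1 + fps_inv (fps_X * U)" for U
    by (rule fps_ext) (auto simp: S_inverse_def fps_inv_def)
  have blocks: "(\<Prod>B\<in>\<pi>. S_inverse U (card B)) = (\<Prod>B\<in>\<pi>. ?f U (card B))"
    if "\<pi> \<in> NC n" for U :: "'a fps" and \<pi>
    using NC_block_card_pos[OF that] by (intro prod.cong) auto
  have "(\<Sum>\<pi>\<in>NC n. (\<Prod>B\<in>\<pi>. S_inverse S (card B)) * (\<Prod>B\<in>Kreweras n \<pi>. S_inverse T (card B))) =
      (\<Sum>\<pi>\<in>NC n. (\<Prod>B\<in>\<pi>. ?f S (card B)) * (\<Prod>B\<in>Kreweras n \<pi>. ?f T (card B)))"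
    using n by (intro sum.cong refl arg_cong2[where f="(*)"] blocks Kreweras_NC)
  also have "\<dots> = tree_series (chain_weight (?f S) (?f S) (?f T) (?f T)) $ n"
    using n by (intro sum_NC_eq_tree_series) simp_all
  also have "\<dots> = S_inverse (S * T) n"
    using n by (simp add: tree_series_S_multiplicative[OF f S f T] S_inverse_def)
  finally show ?thesis .
qed

lemma counit_eq_character: "counit = character (S_inverse 1)"
proof -
  have X: "fps_inv fps_X = (fps_X :: complex fps)"
    using fps_inv[of "fps_X :: complex fps"] by simp
  have "S_inverse 1 (k + 2) = (0 :: complex)" for k by (simp add: S_inverse_def X)
  then show ?thesis by (simp add: counit_def character_def Yextend_def fun_eq_iff)
qed

lemma convolution_S_inverse:
  assumes "S $ 0 = 1" "T $ 0 = 1"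
  shows "convolution (character (S_inverse S)) (character (S_inverse T)) = character (S_inverse (S * T))"
  using assms by (intro convolution_character) (simp_all add: S_inverse_1[simplified] NC_sum_S_inverse)

lemma convolution_linear:
  "convolution (\<lambda>q. \<alpha> q - \<beta> q) (\<lambda>q. \<Sum>j\<in>J. c j * \<eta> j q) p =
    (\<Sum>j\<in>J. c j * (convolution \<alpha> (\<eta> j) p - convolution \<beta> (\<eta> j) p))"
proof -
  have "convolution (\<lambda>q. \<alpha> q - \<beta> q) (\<lambda>q. \<Sum>j\<in>J. c j * \<eta> j q) p =
    (\<Sum>(m, m')\<in>Poly_Mapping.keys (comult p). \<Sum>j\<in>J. c j *
      (Poly_Mapping.lookup (comult p) (m, m') * (\<alpha> (Poly_Mapping.single m 1) * \<eta> j (Poly_Mapping.single m' 1)) -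
       Poly_Mapping.lookup (comult p) (m, m') * (\<beta> (Poly_Mapping.single m 1) * \<eta> j (Poly_Mapping.single m' 1))))"
    unfolding convolution_def tensor_functional_def comp_def case_prod_unfold
    by (simp add: sum_distrib_left algebra_simps)
  also have "\<dots> = (\<Sum>j\<in>J. c j * (convolution \<alpha> (\<eta> j) p - convolution \<beta> (\<eta> j) p))"
    unfolding convolution_def tensor_functional_def comp_def case_prod_unfold
    by (subst sum.swap) (simp add: sum_distrib_left sum_subtractf right_diff_distrib)
  finally show ?thesis .
qed

section \<open>The logarithm of a character\<close>

lemma alternating_binomial_difference:
  fixes x :: "nat \<Rightarrow> 'a::comm_ring_1"
  shows "(\<Sum>j\<le>k. (- 1) ^ j * of_nat (k choose j) * (x j - x (Suc j))) =
    (\<Sum>j\<le>Suc k. (- 1) ^ j * of_nat (Suc k choose j) * x j)"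
proof -
  have "(\<Sum>j\<le>Suc k. (- 1) ^ j * of_nat (Suc k choose j) * x j) =
      x 0 + (\<Sum>j\<le>k. (- 1) ^ Suc j * of_nat (Suc k choose Suc j) * x (Suc j))"
    by (simp add: sum.atMost_Suc_shift del: sum.atMost_Suc binomial_Suc_Suc power_Suc)
  also have "(\<Sum>j\<le>k. (- 1) ^ Suc j * of_nat (Suc k choose Suc j) * x (Suc j)) =
      (\<Sum>j\<le>k. (- 1) ^ Suc j * of_nat (k choose Suc j) * x (Suc j) -
        (- 1) ^ j * of_nat (k choose j) * x (Suc j))"
    by (rule sum.cong) (simp_all add: algebra_simps)
  also have "x 0 + \<dots> = x 0 + (\<Sum>j\<le>k. (- 1) ^ Suc j * of_nat (k choose Suc j) * x (Suc j)) -
      (\<Sum>j\<le>k. (- 1) ^ j * of_nat (k choose j) * x (Suc j))"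
    by (simp only: sum_subtractf add_diff_eq)
  also have "x 0 + (\<Sum>j\<le>k. (- 1) ^ Suc j * of_nat (k choose Suc j) * x (Suc j)) =
      (\<Sum>j\<le>Suc k. (- 1) ^ j * of_nat (k choose j) * x j)"
    by (simp add: sum.atMost_Suc_shift del: sum.atMost_Suc)
  also have "\<dots> = (\<Sum>j\<le>k. (- 1) ^ j * of_nat (k choose j) * x j)"
    by (simp add: binomial_eq_0)
  finally show ?thesis by (simp add: right_diff_distrib sum_subtractf)
qed

text \<open>The counit is the character of $S = 1$. Thus one more factor $\varepsilon - \chi$ replaces the
character of $S^j$ by its difference with that of $S^{j+1}$, so the powers expand like those of $1 - x$.\<close>

lemma conv_power_character:
  assumes S: "S $ 0 = 1"
  shows "conv_power (\<lambda>q. counit q - character (S_inverse S) q) k p =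
    (\<Sum>j\<le>k. (- 1) ^ j * of_nat (k choose j) * character (S_inverse (S ^ j)) p)"
proof (induction k arbitrary: p)
  case 0
  show ?case by (simp add: counit_eq_character)
next
  case (Suc k)
  have pow: "S ^ j $ 0 = 1" for j by (simp add: fps_power_zeroth S)
  have IH: "conv_power (\<lambda>q. counit q - character (S_inverse S) q) k =
      (\<lambda>q. \<Sum>j\<le>k. (- 1) ^ j * of_nat (k choose j) * character (S_inverse (S ^ j)) q)"
    using Suc by (rule ext)
  have "conv_power (\<lambda>q. counit q - character (S_inverse S) q) (Suc k) p =
    convolution (\<lambda>q. counit q - character (S_inverse S) q)
      (\<lambda>q. \<Sum>j\<le>k. (- 1) ^ j * of_nat (k choose j) * character (S_inverse (S ^ j)) q) p"
    by (simp only: conv_power.simps IH)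
  also have "\<dots> = (\<Sum>j\<le>k. (- 1) ^ j * of_nat (k choose j) *
      (character (S_inverse (S ^ j)) p - character (S_inverse (S ^ Suc j)) p))"
    unfolding convolution_linear counit_eq_character
    by (simp add: convolution_S_inverse S pow)
  finally show ?case 
    unfolding alternating_binomial_difference[of k "\<lambda>j. character (S_inverse (S ^ j)) p"] .
qed

text \<open>Lagrange inversion turns the binomial expansion of $(\varepsilon - \chi)^k$ into that of
$(1 - S^{-n})^k$.\<close>

theorem conv_power_Ygen:
  assumes S: "S $ 0 = 1" and n: "n \<ge> 2"
  shows "conv_power (\<lambda>q. counit q - character (S_inverse S) q) k (Ygen n) =
    ((1 - inverse S ^ n) ^ k) $ (n - 1) / of_nat n"
proof -
  define W where "W = inverse S ^ n"
  have pow: "S ^ j $ 0 = 1" for j by (simp add: fps_power_zeroth S)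
  have S_inverse: "S_inverse (S ^ j) n = (W ^ j) $ (n - 1) / of_nat n" for j
  proof -
    have "of_nat n * S_inverse (S ^ j) n = (inverse (S ^ j) ^ n) $ (n - 1)"
      using Lagrange_inversion[of "S ^ j" "n - 1"] pow n by (simp add: S_inverse_def)
    also have "inverse (S ^ j) ^ n = W ^ j"
      unfolding W_def by (metis fps_inverse_power mult.commute power_mult)
    finally show ?thesis using n by (simp add: field_simps)
  qed
  have "(1 - W) ^ k = (\<Sum>j\<le>k. of_nat (k choose j) * (- W) ^ j)"
    using binomial_ring[of "- W" 1 k] by simp
  also have "\<dots> = (\<Sum>j\<le>k. fps_const ((- 1) ^ j * of_nat (k choose j)) * W ^ j)"
  proof (rule sum.cong[OF refl])
    fix j
    have "(- W) ^ j = fps_const ((- 1) ^ j) * W ^ j"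
      by (subst power_minus) (simp flip: fps_const_power fps_const_neg)
    then show "of_nat (k choose j) * (- W) ^ j = fps_const ((- 1) ^ j * of_nat (k choose j)) * W ^ j"
      by (simp only: fps_const_mult[symmetric] fps_of_nat mult_ac)
  qed
  finally have "((1 - W) ^ k) $ (n - 1) = (\<Sum>j\<le>k. (- 1) ^ j * of_nat (k choose j) * (W ^ j) $ (n - 1))"
    by (simp add: fps_sum_nth)
  then show ?thesis
    unfolding W_def[symmetric] using n
    by (simp add: conv_power_character[OF S] character_Ygen S_inverse sum_divide_distrib)
qed

text \<open>The two logarithmic series agree term by term. The factor $\frac1n$ from Lagrange inversion cancels
against the exponent in $\log (S^{-n}) = -n \log S$.\<close>

theorem conv_log_Ygen:
  assumes S: "S $ 0 = 1" and n: "n \<ge> 2"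
  shows "conv_log (character (S_inverse S)) (Ygen n) = - fps_log S $ (n - 1)"
proof -
  define W where "W = inverse S ^ n"
  have W0: "W $ 0 = 1" by (simp add: W_def fps_power_zeroth S)
  have "suminf (\<lambda>l. 1 / of_nat (Suc l) *
        conv_power (\<lambda>q. counit q - character (S_inverse S) q) (Suc l) (Ygen n)) =
      suminf (\<lambda>l. ((1 - W) ^ Suc l) $ (n - 1) / of_nat (Suc l) / of_nat n)"
    by (simp only: conv_power_Ygen[OF S n] W_def) (simp add: mult.commute)
  also have "\<dots> = (\<Sum>l<n. ((1 - W) ^ Suc l) $ (n - 1) / of_nat (Suc l) / of_nat n)"
  proof (rule suminf_finite)
    fix l assume "l \<notin> {..<n}"
    then have "((1 - W) ^ Suc l) $ (n - 1) = 0"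
      using startsby_zero_power_prefix[of "1 - W" "Suc l"] W0 by simp
    then show "((1 - W) ^ Suc l) $ (n - 1) / of_nat (Suc l) / of_nat n = 0" by simp
  qed simp
  also have "\<dots> = - (fps_log W $ (n - 1) / of_nat n)"
    using fps_log_nth[OF W0, of "n - 1" n] by (simp add: sum_divide_distrib)
  also have "fps_log W = - fps_const (of_nat n) * fps_log S"
    unfolding W_def by (rule fps_log_inverse_power[OF S])
  finally show ?thesis using n by (simp add: conv_log_def)
qed

section \<open>The $R$-transform in terms of the $S$-transform\<close>

lemma fps_X_mult_S_transform: "fps_X * S_transform \<mu> = (1 + fps_X) * fps_inv (moment_series \<mu>)"
proof -
  have "fps_X dvd fps_inv (moment_series \<mu>)"
  proof
    show "fps_inv (moment_series \<mu>) = fps_X * fps_shift 1 (fps_inv (moment_series \<mu>))"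
      by (rule fps_ext) (simp add: fps_inv_def)
  qed
  then have "fps_X dvd (1 + fps_X) * fps_inv (moment_series \<mu>)" by (rule dvd_mult)
  then show ?thesis unfolding S_transform_def by (rule dvd_mult_div_cancel)
qed

lemma moment_series_nth:
  assumes "\<mu> \<in> G1" "n \<ge> 1"
  shows "moment_series \<mu> $ n = \<mu> (monom 1 n)"
proof (cases "n = 1")
  case True
  then show ?thesis using assms by (simp add: moment_series_def G1_def)
next
  case False
  then show ?thesis using assms(2) by (simp add: moment_series_def)
qed

lemma fps_inv_eqD:
  fixes F G :: "'a::field fps"
  assumes "F $ 0 = 0" "F $ 1 \<noteq> 0" "G $ 0 = 0" "G $ 1 \<noteq> 0" "fps_inv F = fps_inv G"
  shows "F = G"
  using assms fps_inv_idempotent by metis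

text \<open>Normalised series are exactly the compositional inverses of series $z S$, so an unknown cumulant
series may be written in this form.\<close>

lemma S_inverse_surj:
  fixes F :: "'a::field fps"
  assumes "F $ 0 = 0" "F $ 1 = 1"
  obtains S where "S $ 0 = 1" "fps_nth F = S_inverse S"
proof
  define S where "S = fps_shift 1 (fps_inv F)"
  have X: "fps_X * S = fps_inv F"
    by (rule fps_ext) (simp add: S_def fps_inv_def)
  show "S $ 0 = 1" using assms by (simp add: S_def fps_inv_def)
  show "fps_nth F = S_inverse S"
    using assms by (simp add: fun_eq_iff S_inverse_def X fps_inv_idempotent)
qed

lemma fps_inv_unique:
  fixes F G :: "'a::field fps"
  assumes "F oo G = fps_X" "G $ 0 = 0" "G $ 1 \<noteq> 0"
  shows "fps_inv G = F"
proof -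
  have inv0: "fps_inv G $ 0 = 0" by (simp add: fps_inv_def)
  have "F = F oo (G oo fps_inv G)" by (simp add: fps_inv_right[OF assms(2,3)])
  also have "\<dots> = (F oo G) oo fps_inv G" by (rule fps_compose_assoc[OF inv0 assms(2)])
  also have "\<dots> = fps_inv G" by (simp add: assms(1) inv0)
  finally show ?thesis ..
qed

text \<open>The compositional inverse of $z/(1+z)$ is $z/(1-z)$.\<close>

lemma S_inverse_zeta:
  assumes "k > 0"
  shows "S_inverse (inverse (1 + fps_X)) k = (1 :: 'a::field)"
proof -
  let ?T = "inverse (1 + fps_X) :: 'a fps"
  let ?Y = "fps_X * ?T"
  have T: "?T * (1 + fps_X) = 1" by (rule inverse_mult_eq_1) simp
  have "(1 - fps_X) oo ?Y = 1 - ?Y" by (simp add: fps_compose_sub_distrib)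
  also have "\<dots> = ?T" using T by (simp add: algebra_simps)
  finally have "inverse (1 - fps_X) oo ?Y = inverse ?T" by (simp add: fps_inverse_compose)
  also have "inverse ?T = 1 + fps_X" by (rule fps_inverse_idempotent) simp
  finally have "(fps_X * inverse (1 - fps_X)) oo ?Y = ?Y * (1 + fps_X)"
    by (simp add: fps_compose_mult_distrib)
  also have "\<dots> = fps_X" using T by (simp only: mult.assoc mult_1_right)
  finally have "fps_inv ?Y = fps_X * inverse (1 - fps_X)" by (rule fps_inv_unique) simp_all
  then show ?thesis using assms by (simp add: S_inverse_def fps_inverse_one_minus_fps_X)
qed

text \<open>Weight $1$ on the blocks of $K(\pi)$ belongs to $T = 1/(1+z)$. So the moments with cumulant series
$(z U)^{\langle-1\rangle}$ are the coefficients of $(z U T)^{\langle-1\rangle}$. This equals the moment series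
exactly when $U = S_\mu$, which gives both existence and uniqueness of the cumulants.\<close>

theorem R_transform_nth:
  assumes \<mu>: "\<mu> \<in> G1"
  shows "fps_nth (R_transform \<mu>) = S_inverse (S_transform \<mu>)"
proof -
  let ?S = "S_transform \<mu>" and ?T = "inverse (1 + fps_X) :: complex fps"
  let ?M = "moment_series \<mu>"
  have S0: "?S $ 0 = 1" by (rule S_transform_nth_0)
  have T0: "?T $ 0 = 1" by simp
  have M01: "?M $ 0 = 0" "?M $ 1 = 1" by (simp_all add: moment_series_def)
  have invinv: "fps_inv (fps_inv ?M) = ?M"
    by (rule fps_inv_idempotent) (simp_all add: moment_series_def)
  have TX: "?T * (1 + fps_X) = 1" by (rule inverse_mult_eq_1) simp
  have XST: "fps_X * (?S * ?T) = fps_inv ?M"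
  proof -
    have "fps_X * (?S * ?T) = (fps_X * ?S) * ?T" by (simp only: mult.assoc)
    also have "\<dots> = fps_inv ?M * (?T * (1 + fps_X))"
      unfolding fps_X_mult_S_transform by (simp only: mult_ac)
    finally show ?thesis by (simp add: TX)
  qed
  have moments: "(\<Sum>\<pi>\<in>NC n. \<Prod>B\<in>\<pi>. S_inverse U (card B)) = S_inverse (U * ?T) n"
    if "U $ 0 = 1" "n \<ge> 1" for U :: "complex fps" and n
  proof -
    have "(\<Prod>B\<in>Kreweras n \<pi>. S_inverse ?T (card B)) = 1" if "\<pi> \<in> NC n" for \<pi>
      using NC_block_card_pos[OF Kreweras_NC[OF that]] \<open>n \<ge> 1\<close>
      by (intro prod.neutral) (auto simp: S_inverse_zeta)
    then show ?thesis using NC_sum_S_inverse[OF that(1) T0, of n] that(2) by simp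
  qed
  have "R_transform \<mu> = Abs_fps (S_inverse ?S)"
    unfolding R_transform_def
  proof (rule the_equality)
    have "S_inverse (?S * ?T) n = ?M $ n" for n
      unfolding S_inverse_def XST invinv ..
    then show "fps_nth (Abs_fps (S_inverse ?S)) 0 = 0 \<and> (\<forall>n\<ge>1. \<mu> (monom 1 n) =
        (\<Sum>\<pi>\<in>NC n. \<Prod>B\<in>\<pi>. fps_nth (Abs_fps (S_inverse ?S)) (card B)))"
      by (simp add: moments S0 moment_series_nth[OF \<mu>])
  next
    fix R :: "complex fps"
    assume R: "fps_nth R 0 = 0 \<and>
      (\<forall>n\<ge>1. \<mu> (monom 1 n) = (\<Sum>\<pi>\<in>NC n. \<Prod>B\<in>\<pi>. fps_nth R (card B)))"
    have "NC 1 = {{{1}}}"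
    proof (intro equalityI subsetI)
      fix \<pi> assume "\<pi> \<in> NC 1"
      then have "\<Union>\<pi> = {1}" "{} \<notin> \<pi>" by (auto simp: NC_def partition_on_def)
      moreover from this have "B = {1}" if "B \<in> \<pi>" for B
        using that subset_singletonD[of B 1] by blast
      ultimately have "\<pi> \<subseteq> {{1}}" "\<pi> \<noteq> {}" by auto
      then show "\<pi> \<in> {{{1}}}" by blast
    qed (auto simp: NC_def noncrossing_def partition_on_def)
    then have "R $ 1 = 1" using R \<mu> by (simp add: G1_def)
    then obtain U where U: "U $ 0 = 1" "fps_nth R = S_inverse U"
      using R S_inverse_surj by blast
    have "S_inverse (U * ?T) n = ?M $ n" for n
    proof (cases "n = 0")
      case False
      then show ?thesis using R moments[OF U(1)] moment_series_nth[OF \<mu>, of n] U(2) by simp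
    qed (simp add: M01)
    then have "fps_inv (fps_X * (U * ?T)) = ?M" by (intro fps_ext) (simp add: S_inverse_def)
    also have "\<dots> = fps_inv (fps_X * (?S * ?T))" by (simp only: XST invinv)
    finally have "fps_X * (U * ?T) = fps_X * (?S * ?T)"
      by (rule fps_inv_eqD[rotated 4]) (simp_all add: U S0)
    then have "U * (?T * (1 + fps_X)) = ?S * (?T * (1 + fps_X))"
      by (simp add: mult.assoc[symmetric])
    then have "U = ?S" by (simp add: TX)
    then show "R = Abs_fps (S_inverse ?S)" using U(2) by (intro fps_ext) simp
  qed
  then show ?thesis by (simp add: fun_eq_iff)
qed

theorem theorem1p8:
  fixes \<mu> :: "complex poly \<Rightarrow> complex"
  assumes "\<mu> \<in> G1"
  shows "LS_transform \<mu> = - fps_X * fps_log (S_transform \<mu>)"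
proof (rule fps_ext)
  fix n
  have S0: "S_transform \<mu> $ 0 = 1" by (rule S_transform_nth_0)
  have character: "LS_character \<mu> = character (S_inverse (S_transform \<mu>))"
    by (simp add: LS_character_def character_def R_transform_nth[OF assms])
  have "fps_log (S_transform \<mu>) $ 0 = 0" using fps_log_nth[OF S0 le0, of 0] by simp
  then show "LS_transform \<mu> $ n = (- fps_X * fps_log (S_transform \<mu>)) $ n"
    by (cases "n \<ge> 2") (auto simp: LS_transform_def character conv_log_Ygen[OF S0] not_le less_2_cases_iff)
qed

end
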